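(* Let $0<s<1<p<\infty$ and let $M$ be the set of all $p$-harmonic functions in $B_1$. Given $k\in\mathbb{N}\cup\{0\}$, $f\in C^k(\overline{B}_1)$ and $\varepsilon>0$, there exists $u\in\operatorname{span}(M)$ such that $\|f-u\|_{C^k(\overline{B}_1)}<\varepsilon$.
   Context: $B_r\subset\mathbb{R}^d$ denotes the open ball with center at $0\in\mathbb{R}^d$ and radius $r>0$. For an open set $U\subset\mathbb{R}^d$ and $k\in\mathbb{N}\cup\{0\}$, $C^k(\overline{U})$ is the set of $\varphi\in C^k(U)$ such that $D^\alpha\varphi$ is uniformly continuous on bounded subsets of $U$ for all $|\alpha|\le k$. If $\varphi\in C^k(\overline{U})$ is bounded, $\|\varphi\|_{C^k(\overline{U})}=\sum_{|\alpha|\le k}\|D^\alpha\varphi\|_{C(\overline{U})}$, where $C(\overline{U})=C^0(\overline{U})$ and $\|\varphi\|_{C(\overline{U})}=\sup\{|\varphi(x)|:x\in U\}$. The fractional $p$-Laplacian operator $(-\Delta_p)^s$, with $0<s<1<p<\infty$, is defined, for $u:\mathbb{R}^d\to\mathbb{R}$ smooth enough, by $$(-\Delta_p)^s u(x)=\text{P.V.}\int_{\mathbb{R}^d}\frac{|u(x)-u(x+y)|^{p-2}(u(x)-u(x+y))}{|y|^{d+sp}}\,dy,$$ where P.V. stands for the (Cauchy) principal value. A smooth function $u:\mathbb{R}^d\to\mathbb{R}$ is called $p$-harmonic in $B_1$ if $(-\Delta_p)^s u(x)=0$ for each $x\in B_1$. $\operatorname{span}(M)$ is the linear span of $M$. 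*)

theory Defs
  imports "HOL-Analysis.Analysis" "HOL-Library.Function_Algebras" "HOL-Library.Multiset"
begin

definition partial_deriv :: "'a::euclidean_space \<Rightarrow> ('a \<Rightarrow> real) \<Rightarrow> 'a \<Rightarrow> real" where
  "partial_deriv b \<phi> x = deriv (\<lambda>t::real. \<phi> (x + t *\<^sub>R b)) 0"

definition partially_differentiable_at ::
    "'a::euclidean_space \<Rightarrow> ('a \<Rightarrow> real) \<Rightarrow> 'a \<Rightarrow> bool" where
  "partially_differentiable_at b \<phi> x \<longleftrightarrow>
     (\<lambda>t::real. \<phi> (x + t *\<^sub>R b)) field_differentiable (at 0)"

definition iter_partial :: "'a::euclidean_space list \<Rightarrow> ('a \<Rightarrow> real) \<Rightarrow> 'a \<Rightarrow> real" where
  "iter_partial bs \<phi> = foldr partial_deriv bs \<phi>"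

text \<open>All iterated partial derivatives of order at most \<open>k\<close> exist and are continuous on the open
  set \<open>U\<close>. The values of \<open>\<phi>\<close> outside \<open>U\<close> play no role.\<close>

definition Ck_on :: "nat \<Rightarrow> 'a::euclidean_space set \<Rightarrow> ('a \<Rightarrow> real) set" where
  "Ck_on k U = {\<phi>. \<forall>bs. set bs \<subseteq> Basis \<and> length bs \<le> k \<longrightarrow>
      continuous_on U (iter_partial bs \<phi>) \<and>
      (length bs < k \<longrightarrow>
        (\<forall>b\<in>Basis. \<forall>x\<in>U. partially_differentiable_at b (iter_partial bs \<phi>) x))}"

text \<open>A multi-index \<open>\<alpha>\<close> is a finite multiset of coordinate directions: \<open>count \<alpha> b\<close> is its entry in
  direction \<open>b\<close>, and \<open>size \<alpha>\<close> is its order. For functions of class \<open>C\<^sup>k\<close> and \<open>size \<alpha> \<le> k\<close> the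
  order of differentiation chosen in \<open>multi_deriv\<close> is immaterial, by Schwarz's theorem.\<close>

definition multi_indices :: "nat \<Rightarrow> 'a::euclidean_space multiset set" where
  "multi_indices k = {\<alpha>. set_mset \<alpha> \<subseteq> Basis \<and> size \<alpha> \<le> k}"

definition multi_deriv :: "'a::euclidean_space multiset \<Rightarrow> ('a \<Rightarrow> real) \<Rightarrow> 'a \<Rightarrow> real" where
  "multi_deriv \<alpha> \<phi> = iter_partial (SOME bs. mset bs = \<alpha>) \<phi>"

text \<open>\<open>Ck_closure k U\<close> and \<open>Ck_norm k U\<close> are the space and the norm usually written with the closure
  of \<open>U\<close>; the argument is the open set \<open>U\<close> itself. The suprema in \<open>Ck_norm\<close> are only meaningful
  when the derivatives are bounded on \<open>U\<close>, as is the case for bounded \<open>U\<close> and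
  \<open>\<phi> \<in> Ck_closure k U\<close>.\<close>

definition Ck_closure :: "nat \<Rightarrow> 'a::euclidean_space set \<Rightarrow> ('a \<Rightarrow> real) set" where
  "Ck_closure k U = {\<phi> \<in> Ck_on k U. \<forall>\<alpha>\<in>multi_indices k. \<forall>B. B \<subseteq> U \<and> bounded B \<longrightarrow>
      uniformly_continuous_on B (multi_deriv \<alpha> \<phi>)}"

definition Ck_norm :: "nat \<Rightarrow> 'a::euclidean_space set \<Rightarrow> ('a \<Rightarrow> real) \<Rightarrow> real" where
  "Ck_norm k U \<phi> = (\<Sum>\<alpha>\<in>multi_indices k. SUP x\<in>U. \<bar>multi_deriv \<alpha> \<phi> x\<bar>)"

definition frac_p_integrand ::
    "real \<Rightarrow> real \<Rightarrow> ('a::euclidean_space \<Rightarrow> real) \<Rightarrow> 'a \<Rightarrow> 'a \<Rightarrow> real" where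
  "frac_p_integrand s p u x y =
     \<bar>u x - u (x + y)\<bar> powr (p - 2) * (u x - u (x + y)) / norm y powr (real DIM('a) + s * p)"

text \<open>The fractional \<open>p\<close>-Laplacian of \<open>u\<close> at \<open>x\<close> exists as a principal value and equals \<open>L\<close>.
  A relation is used because the Lebesgue integral and the limit are total functions in HOL:
  integrability away from the singularity and convergence of the truncated integrals have to be
  demanded explicitly. For \<open>u x = u (x + y)\<close> the integrand is \<open>0\<close>, also when \<open>p < 2\<close>.\<close>

definition has_frac_p_laplacian ::
    "real \<Rightarrow> real \<Rightarrow> ('a::euclidean_space \<Rightarrow> real) \<Rightarrow> 'a \<Rightarrow> real \<Rightarrow> bool" where
  "has_frac_p_laplacian s p u x L \<longleftrightarrow>
     (\<forall>r>0. set_integrable lborel (- ball 0 r) (frac_p_integrand s p u x)) \<and>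
     ((\<lambda>r. set_lebesgue_integral lborel (- ball 0 r) (frac_p_integrand s p u x))
        \<longlongrightarrow> L) (at_right 0)"

text \<open>Smoothness of a \<open>p\<close>-harmonic function is understood as is usual for nonlocal equations:
  \<open>u\<close> is \<open>C\<^sup>\<infinity>\<close> near the closed ball, on which the equation is imposed pointwise, and merely
  continuous elsewhere. So \<open>x \<mapsto> (max 0 (x \<bullet> e + 2)) powr s\<close>, with \<open>e\<close> a unit vector, is
  admissible, although it is not differentiable on the hyperplane \<open>x \<bullet> e = - 2\<close>.\<close>

definition p_harmonic_in_unit_ball ::
    "real \<Rightarrow> real \<Rightarrow> ('a::euclidean_space \<Rightarrow> real) \<Rightarrow> bool" where
  "p_harmonic_in_unit_ball s p u \<longleftrightarrow>
     continuous_on UNIV u \<and>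
     (\<exists>V. open V \<and> cball 0 1 \<subseteq> V \<and> (\<forall>k. u \<in> Ck_on k V)) \<and>
     (\<forall>x\<in>ball 0 1. has_frac_p_laplacian s p u x 0)"

text \<open>The function type is not an instance of \<^class>\<open>real_vector\<close>, so the linear span is taken with
  respect to the explicit pointwise scalar multiplication.\<close>

abbreviation fun_scale :: "real \<Rightarrow> ('a \<Rightarrow> real) \<Rightarrow> 'a \<Rightarrow> real" where
  "fun_scale \<equiv> \<lambda>c u x. c * u x"

lemma vector_space_fun_scale: "vector_space (fun_scale :: real \<Rightarrow> ('a \<Rightarrow> real) \<Rightarrow> 'a \<Rightarrow> real)"
  by unfold_locales (auto simp: fun_eq_iff algebra_simps)

abbreviation fun_span :: "('a \<Rightarrow> real) set \<Rightarrow> ('a \<Rightarrow> real) set" where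
  "fun_span \<equiv> module.span fun_scale"

end

theory Submission
  imports Defs
begin

text \<open>The span of the \<open>p\<close>-harmonic functions is large because it contains the truncated plane waves
  \<open>x \<mapsto> (1 + a \<bullet> x)\<^sub>+ powr s\<close> for all vectors \<open>a\<close> of norm less than \<open>1\<close>, and because
  differentiating these in \<open>a\<close> produces all powers of linear forms.

  \<^bold>\<open>Plane waves are \<open>p\<close>-harmonic.\<close> At a point \<open>x\<close>, put \<open>c = 1 + a \<bullet> x > 0\<close> and \<open>b = a / c\<close>. The integrand
  of the fractional \<open>p\<close>-Laplacian is a constant times \<open>h(b \<bullet> y) |y| powr (-d - sp)\<close>, where \<open>h\<close> is the integrand
  numerator of the one-dimensional profile \<open>(1 + t)\<^sub>+ powr s\<close> at \<open>t = 0\<close>. Reflecting \<open>y \<mapsto> -y\<close> replaces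
  \<open>h(t)\<close> by \<open>h(t) + h(-t)\<close> on the half-space \<open>b \<bullet> y > 0\<close>, and by scaling the kernel on this half-space
  pushes forward under \<open>y \<mapsto> b \<bullet> y\<close> to a multiple of \<open>t powr (-1 - sp) dt\<close> on the positive axis
  (\<open>ridge_pushforward\<close>). So the claim reduces, with no choice of coordinates, to a one-dimensional
  cancellation (\<open>jump_cancellation\<close>): the substitution \<open>1 + t = 1 / (1 - v)\<close> maps the integral over
  \<open>t > 0\<close> to one over \<open>0 < v < 1\<close>, which differs from the integral over \<open>-1 < t < 0\<close> by an exact
  derivative; the boundary term of that derivative balances the explicit contribution of \<open>t < -1\<close>.
  The symmetrised integrand is absolutely integrable, so the principal value is an ordinary limit by dominated convergence (\<open>jump_ridge_principal_value\<close>).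

  \<^bold>\<open>Plane waves span a dense subspace.\<close> Since \<open>s\<close> is not an integer, every Taylor coefficient of
  \<open>(1 + w) powr s\<close> at \<open>0\<close> is nonzero. Subtracting from \<open>(1 + t (a \<bullet> x)) powr s\<close> its Taylor terms below order \<open>n\<close>,
  dividing by \<open>t ^ n\<close> and letting \<open>t\<close> tend to \<open>0\<close> shows by induction that \<open>(a \<bullet> x) ^ n\<close> is a limit in
  \<open>C\<^sup>k\<close> of elements of the span (\<open>power_mem_Ck_limits\<close>). Hence so is \<open>exp (a \<bullet> x)\<close>, by its power series.
  All these are functions of \<open>a \<bullet> x\<close> alone, so only derivatives in one variable are
  estimated. Sums of exponentials form an algebra that separates points, hence they approximate
  a bump function \<open>\<rho>\<close> uniformly on a box by some \<open>q\<close>. For \<open>F\<close> of class \<open>C\<^sup>k\<close> with compact support, the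
  convolution of \<open>F\<close> with \<open>q\<close> is again a sum of exponentials, because \<open>exp (v \<bullet> (x - y))\<close> factorises; and its
  derivatives are the convolutions of the derivatives of \<open>F\<close> with \<open>q\<close>, so it is \<open>C\<^sup>k\<close>-close to \<open>F\<close>
  although \<open>q\<close> is only uniformly close to \<open>\<rho>\<close> (\<open>compactly_supported_mem_Ck_limits\<close>). A general \<open>f\<close> is
  first replaced by \<open>f(l x)\<close> with \<open>l < 1\<close> near \<open>1\<close>, which is defined on a larger ball and can be cut off there.\<close>

section \<open>Cancellation in one dimension\<close>

locale frac_exponents =
  fixes s p :: real
  assumes s_pos: "0 < s" and s_less: "s < 1" and p_greater: "1 < p"
begin

text \<open>\<open>jump t\<close> is the numerator of the Laplacian integrand of the profile \<open>(1 + t)\<^sub>+ powr s\<close>, centred at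
  \<open>0\<close>, where the profile has value \<open>1\<close>. For \<open>t > 0\<close>, the densities \<open>loss t\<close> and \<open>gain t\<close> are the absolute values of the
  integrand at \<open>-t\<close>, where the profile is smaller than \<open>1\<close>, and at \<open>t\<close>, where it is larger.\<close>

definition jump :: "real \<Rightarrow> real" where
  "jump t = \<bar>1 - max 0 (1 + t) powr s\<bar> powr (p - 2) * (1 - max 0 (1 + t) powr s)"

definition loss :: "real \<Rightarrow> real" where
  "loss t = (1 - max 0 (1 - t) powr s) powr (p - 1) * t powr (-1 - s * p)"

definition gain :: "real \<Rightarrow> real" where
  "gain t = ((1 + t) powr s - 1) powr (p - 1) * t powr (-1 - s * p)"

text \<open>Bernoulli's inequality with exponent below \<open>1\<close>; applied at \<open>x\<close> and \<open>-x\<close> it says that the profile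
  drops more behind the centre than it rises ahead of it, which gives the sign of \<open>loss - gain\<close>.\<close>

lemma powr_Bernoulli:
  assumes "-1 \<le> x" shows "(1 + x) powr s \<le> 1 + s * x"
proof (cases "x = -1")
  case True
  then show ?thesis using s_less by simp
next
  case False
  with assms have x: "0 < 1 + x" by simp
  have "exp ((1 - s) *\<^sub>R 0 + s *\<^sub>R ln (1 + x)) \<le> (1 - s) * exp 0 + s * exp (ln (1 + x))"
    using s_pos s_less by (intro convex_onD[OF exp_convex]) auto
  then show ?thesis using x by (simp add: powr_def algebra_simps)
qed

lemma one_minus_powr_bounds:
  assumes "0 < v" "v \<le> 1"
  shows "0 < 1 - (1 - v) powr s" "1 - (1 - v) powr s \<le> v" 
    "(1 + v) powr s - 1 \<le> 1 - (1 - v) powr s" "0 < (1 + v) powr s - 1"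
proof -
  have "(1 - v) powr s < 1 powr s" using assms s_pos by (intro powr_less_mono2) auto
  then show "0 < 1 - (1 - v) powr s" by simp
  have "(1 - v) powr 1 \<le> (1 - v) powr s" using assms s_less by (intro powr_mono') auto
  then show "1 - (1 - v) powr s \<le> v" using assms by simp
  show "(1 + v) powr s - 1 \<le> 1 - (1 - v) powr s"
    using powr_Bernoulli[of v] powr_Bernoulli[of "-v"] assms by simp
  have "1 powr s < (1 + v) powr s" using assms s_pos by (intro powr_less_mono2) auto
  then show "0 < (1 + v) powr s - 1" by simp
qed

lemma jump_pos_neg:
  assumes "0 < t"
  shows "(jump t + jump (- t)) * t powr (-1 - s * p) = loss t - gain t"
proof -
  have "max 0 (1 - t) powr s < 1"
  proof (cases "t \<le> 1")
    case True
    then show ?thesis using one_minus_powr_bounds(1)[OF assms True] by (simp add: max_def)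
  qed (simp add: max_def)
  moreover have "1 < (1 + t) powr s"
    using assms s_pos by simp
  moreover have "x powr (p - 2) * x = x powr (p - 1)" if "0 < x" for x :: real
    using that powr_add[of x "p - 2" 1] by simp
  ultimately have "jump t = - (((1 + t) powr s - 1) powr (p - 1))"
    "jump (- t) = (1 - max 0 (1 - t) powr s) powr (p - 1)"
    using assms
    by (simp_all add: jump_def max_def) (smt (verit) minus_mult_right)+
  then show ?thesis by (simp add: loss_def gain_def algebra_simps)
qed

lemma loss_nonneg: "0 \<le> loss t" and gain_nonneg: "0 \<le> gain t"
  by (simp_all add: loss_def gain_def)

lemma gain_le_loss: "0 < t \<Longrightarrow> t \<le> 1 \<Longrightarrow> gain t \<le> loss t"
  unfolding gain_def loss_def
  using one_minus_powr_bounds[of t] p_greater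
  by (intro mult_right_mono powr_mono2) (auto simp: max_def)

text \<open>The density of \<open>gain\<close> in the variable \<open>v\<close> with \<open>1 + t = 1 / (1 - v)\<close>, and a primitive of its
  excess over \<open>loss\<close>.\<close>

definition reflected_gain :: "real \<Rightarrow> real" where
  "reflected_gain v = loss v * (1 - v) powr (s - 1)"

definition primitive :: "real \<Rightarrow> real" where
  "primitive v = (1 - (1 - v) powr s) powr p * v powr (- (s * p)) / (s * p)"

text \<open>The key identity: writing \<open>W = 1 - (1 - v) powr s\<close>, the product rule yields
  \<open>W powr (p - 1) * v powr (-1 - s p)\<close> times \<open>(1 - v) powr (s - 1) * v - W\<close>, and this factor
  equals \<open>(1 - v) powr (s - 1) - 1\<close> because \<open>(1 - v) powr s = (1 - v) powr (s - 1) * (1 - v)\<close>.\<close>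

lemma primitive_deriv:
  assumes "0 < v" "v < 1"
  shows "(primitive has_real_derivative reflected_gain v - loss v) (at v)"
proof -
  have sp: "s * p > 0" using s_pos p_greater by simp
  define W where "W = 1 - (1 - v) powr s"
  have W: "0 < W" using one_minus_powr_bounds(1)[of v] assms by (simp add: W_def)
  have e1: "W powr p = W powr (p - 1) * W" using W powr_add[of W "p - 1" 1] by simp
  have e2: "v powr (- (s * p)) = v powr (-1 - s * p) * v"
    using assms powr_add[of v "-1 - s * p" 1] by simp
  have e3: "(1 - v) powr s = (1 - v) powr (s - 1) * (1 - v)"
    using assms powr_add[of "1 - v" "s - 1" 1] by simp
  have e4: "- (s * p) - 1 = -1 - s * p" by simp
  have "((\<lambda>v. (1 - (1 - v) powr s)) has_real_derivative (s * (1 - v) powr (s - 1))) (at v)"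
    using assms by (auto intro!: derivative_eq_intros)
  from DERIV_fun_powr[OF this, of p]
  have D1: "((\<lambda>v. (1 - (1 - v) powr s) powr p) has_real_derivative
     p * W powr (p - 1) * (s * (1 - v) powr (s - 1))) (at v)"
    using W by (simp add: W_def)
  have D2: "((\<lambda>v. v powr (- (s * p))) has_real_derivative - (s * p) * v powr (-1 - s * p)) (at v)"
    using has_real_derivative_powr[OF assms(1), of "- (s * p)"] unfolding e4 .
  have "((\<lambda>v. (1 - (1 - v) powr s) powr p * v powr (- (s * p))) has_real_derivative
      (p * W powr (p - 1) * (s * (1 - v) powr (s - 1))) * v powr (- (s * p)) 
       + W powr p * (- (s * p) * v powr (-1 - s * p))) (at v)"
    using DERIV_mult[OF D1 D2] by (simp add: W_def algebra_simps)
  then have "(primitive has_real_derivative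
      ((p * W powr (p - 1) * (s * (1 - v) powr (s - 1))) * v powr (- (s * p)) 
       + W powr p * (- (s * p) * v powr (-1 - s * p))) / (s * p)) (at v)"
    unfolding primitive_def by (rule DERIV_cdivide)
  also have "((p * W powr (p - 1) * (s * (1 - v) powr (s - 1))) * v powr (- (s * p)) 
       + W powr p * (- (s * p) * v powr (-1 - s * p))) / (s * p)
       = W powr (p - 1) * v powr (-1 - s * p) * ((1 - v) powr (s - 1) * v - W)"
    unfolding e1 e2 using s_pos p_greater by (simp add: field_simps)
  also have "(1 - v) powr (s - 1) * v - W = (1 - v) powr (s - 1) - 1"
    unfolding W_def e3 by (simp add: algebra_simps)
  also have "W powr (p - 1) * v powr (-1 - s * p) * ((1 - v) powr (s - 1) - 1) = reflected_gain v - loss v"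
    using assms by (simp add: reflected_gain_def loss_def W_def max_def algebra_simps)
  finally show ?thesis .
qed

lemma primitive_nonneg: "0 \<le> primitive v"
  using s_pos p_greater by (simp add: primitive_def)

lemma primitive_le: assumes "0 < v" "v \<le> 1" shows "primitive v \<le> v powr (p - s * p) / (s * p)"
proof -
  have "(1 - (1 - v) powr s) powr p \<le> v powr p"
    using one_minus_powr_bounds[OF assms] p_greater by (intro powr_mono2) auto
  then have "(1 - (1 - v) powr s) powr p * v powr (- (s * p)) \<le> v powr p * v powr (- (s * p))"
    by (intro mult_right_mono) auto
  also have "\<dots> = v powr (p - s * p)" by (simp add: powr_add[symmetric])
  finally show ?thesis unfolding primitive_def using s_pos p_greater by (intro divide_right_mono) auto
qed

lemma continuous_on_loss_base:
  assumes "0 < e"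
  shows "continuous_on {e..1} (\<lambda>v. 1 - (1 - v) powr s)"
    and "v \<in> {e..1} \<Longrightarrow> 1 - (1 - v) powr s \<noteq> 0"
proof -
  show "continuous_on {e..1} (\<lambda>v. 1 - (1 - v) powr s)"
    using s_pos by (intro continuous_on_diff continuous_on_powr' continuous_intros) auto
  show "1 - (1 - v) powr s \<noteq> 0" if "v \<in> {e..1}"
    using one_minus_powr_bounds(1)[of v] that assms by auto
qed

lemma diff_has_integral:
  assumes "0 < e" "e \<le> 1"
  shows "((\<lambda>v. reflected_gain v - loss v) has_integral (1 / (s * p) - primitive e)) {e..1}"
proof -
  have "continuous_on {e..1} primitive"
  proof -
    have "continuous_on {e..1} (\<lambda>v. (1 - (1 - v) powr s) powr p)"
      using continuous_on_loss_base[OF assms(1)] by (intro continuous_on_powr continuous_on_const) auto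
    moreover have "continuous_on {e..1} (\<lambda>v. v powr (- (s * p)))"
      using assms by (intro continuous_on_powr continuous_intros) auto
    ultimately show ?thesis
      unfolding primitive_def using s_pos p_greater by (intro continuous_on_divide continuous_on_mult) auto
  qed
  then have "((\<lambda>v. reflected_gain v - loss v) has_integral (primitive 1 - primitive e)) {e..1}"
    using assms primitive_deriv
    by (intro fundamental_theorem_of_calculus_interior)
       (auto simp: has_real_derivative_iff_has_vector_derivative[symmetric])
  then show ?thesis by (simp add: primitive_def)
qed

lemma loss_integrable_Icc:
  assumes "0 < e" shows "loss integrable_on {e..1}"
proof -
  have "continuous_on {e..1} (\<lambda>v. (1 - (1 - v) powr s) powr (p - 1))"
    using continuous_on_loss_base[OF assms] by (intro continuous_on_powr continuous_on_const) auto
  moreover have "continuous_on {e..1} (\<lambda>v. v powr (-1 - s * p))"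
    using assms by (intro continuous_on_powr continuous_on_const continuous_on_id) auto
  ultimately have "continuous_on {e..1} (\<lambda>t. (1 - (1 - t) powr s) powr (p - 1) * t powr (-1 - s * p))"
    by (rule continuous_on_mult)
  then have "(\<lambda>t. (1 - (1 - t) powr s) powr (p - 1) * t powr (-1 - s * p)) integrable_on {e..1}"
    by (rule integrable_continuous_interval)
  then show ?thesis
    by (rule integrable_eq) (simp add: loss_def max_def)
qed

text \<open>Beyond \<open>t = 1\<close> the truncated profile vanishes at \<open>-t\<close>, so only the kernel is integrated. The value
  is exactly \<open>primitive 1\<close>, which makes the boundary terms cancel in \<open>truncated_integral\<close>.\<close>

lemma loss_has_integral_Ici: "(loss has_integral (1 / (s * p))) {1..}"
proof -
  have "((\<lambda>t. t powr (-1 - s * p)) has_integral (1 / (s * p))) {1::real..}"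
    using has_integral_powr_to_inf[of "-1 - s * p" 1] s_pos p_greater by simp
  then show ?thesis
    by (rule has_integral_eq[rotated]) (auto simp: loss_def max_def)
qed

lemma reflected_gain_integrable:
  assumes "0 < e" "e \<le> 1" shows "reflected_gain integrable_on {e..1}"
  using integrable_add[OF has_integral_integrable[OF diff_has_integral[OF assms]] 
      loss_integrable_Icc[OF assms(1)]] by simp

lemma gain_substitution:
  assumes "0 < v" "v < 1"
  shows "\<bar>1 / (1 - v)\<^sup>2\<bar> * gain (v / (1 - v)) = reflected_gain v"
proof -
  define z where "z = 1 - v"
  have z: "0 < z" "z < 1" "v = 1 - z" using assms by (auto simp: z_def)
  have a: "1 + v / (1 - v) = 1 / z" using z by (simp add: field_simps)
  have "(1 / z) powr s - 1 = (1 - z powr s) * z powr (- s)"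
    using z by (simp add: powr_divide powr_minus field_simps)
  then have b: "((1 / z) powr s - 1) powr (p - 1) = (1 - z powr s) powr (p - 1) * z powr (- s * (p - 1))"
    using z powr_less_mono2[of s z 1] s_pos by (simp add: powr_mult powr_powr)
  have c: "(v / (1 - v)) powr (-1 - s * p) = v powr (-1 - s * p) * z powr (1 + s * p)"
  proof -
    have "v / (1 - v) = v * z powr (-1)" using z by (simp add: powr_minus divide_inverse)
    then have "(v / (1 - v)) powr (-1 - s * p) = (v * z powr (-1)) powr (-1 - s * p)"
      by (simp only:)
    also have "\<dots> = v powr (-1 - s * p) * (z powr (-1)) powr (-1 - s * p)"
      by (rule powr_mult)
    also have "(z powr (-1)) powr (-1 - s * p) = z powr (1 + s * p)"
      unfolding powr_powr by (rule arg_cong[where f = "\<lambda>r. z powr r"]) simp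
    finally show ?thesis .
  qed
  have d: "1 / (1 - v)\<^sup>2 = z powr (-2)" using z by (simp add: powr_minus divide_inverse)
  have e: "z powr (-2) * (z powr (- s * (p - 1)) * z powr (1 + s * p)) = z powr (s - 1)"
    by (simp add: powr_add[symmetric] algebra_simps)
  have "\<bar>1 / (1 - v)\<^sup>2\<bar> * gain (v / (1 - v)) = (1 - z powr s) powr (p - 1) * v powr (-1 - s * p)
      * (z powr (-2) * (z powr (- s * (p - 1)) * z powr (1 + s * p)))"
    unfolding gain_def a b c d by simp
  also have "\<dots> = reflected_gain v" unfolding e using assms by (simp add: reflected_gain_def loss_def z_def max_def)
  finally show ?thesis .
qed

text \<open>The substitution \<open>t = v / (1 - v)\<close> maps the truncation \<open>t \<ge> e\<close> to \<open>v \<ge> e / (1 + e)\<close>, slightly below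
  \<open>e\<close>; \<open>truncated_integral\<close> records the mismatch as an integral between these two points.\<close>

lemma gain_has_integral:
  assumes "0 < e"
  shows "(gain has_integral integral {e / (1 + e)..1} reflected_gain) {e..}"
proof -
  define c where "c = e / (1 + e)"
  have c: "0 < c" "c < 1" using assms by (auto simp: c_def field_simps)
  have im: "(\<lambda>v. v / (1 - v)) ` {c<..<1} = {e<..}"
  proof (intro set_eqI iffI)
    fix t assume "t \<in> (\<lambda>v. v / (1 - v)) ` {c<..<1}"
    then obtain v where v: "v \<in> {c<..<1}" "t = v / (1 - v)" by blast
    then have "e < v * (1 + e)" using assms by (simp add: c_def field_simps)
    then have "e * (1 - v) < v" by (simp add: algebra_simps)
    then show "t \<in> {e<..}" using v by (simp add: pos_less_divide_eq)
  next
    fix t assume t: "t \<in> {e<..}"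
    then show "t \<in> (\<lambda>v. v / (1 - v)) ` {c<..<1}"
      using assms by (intro image_eqI[of _ _ "t / (1 + t)"]) (auto simp: c_def field_simps)
  qed
  have "inj_on (\<lambda>v::real. v / (1 - v)) {c<..<1}"
    by (auto simp: inj_on_def divide_simps algebra_simps)
  moreover have "((\<lambda>v. v / (1 - v)) has_field_derivative 1 / (1 - v)\<^sup>2) (at v within {c<..<1})"
    if "v \<in> {c<..<1}" for v
    using that by (auto intro!: derivative_eq_intros simp: field_simps power2_eq_square)
  ultimately have iff: "(\<lambda>x. \<bar>1 / (1 - x)\<^sup>2\<bar> * gain (x / (1 - x))) absolutely_integrable_on {c<..<1} \<and>
      integral {c<..<1} (\<lambda>x. \<bar>1 / (1 - x)\<^sup>2\<bar> * gain (x / (1 - x))) = b \<longleftrightarrow>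
      gain absolutely_integrable_on {e<..} \<and> integral {e<..} gain = b" for b
    unfolding im[symmetric]
    by (intro has_absolute_integral_change_of_variables_1') auto
  have g: "reflected_gain integrable_on {c<..<1}"
    using reflected_gain_integrable[of c] c integrable_on_Icc_iff_Ioo by auto
  then have "reflected_gain absolutely_integrable_on {c<..<1}"
    by (rule nonnegative_absolutely_integrable_1) (simp add: reflected_gain_def loss_nonneg)
  then have "(\<lambda>x. \<bar>1 / (1 - x)\<^sup>2\<bar> * gain (x / (1 - x))) absolutely_integrable_on {c<..<1}"
    by (rule absolutely_integrable_spike[OF _ negligible_empty])
       (use c gain_substitution in auto)
  moreover have "integral {c<..<1} (\<lambda>x. \<bar>1 / (1 - x)\<^sup>2\<bar> * gain (x / (1 - x))) = integral {c<..<1} reflected_gain"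
    using c gain_substitution by (intro integral_cong) auto
  ultimately have "gain absolutely_integrable_on {e<..} \<and> integral {e<..} gain = integral {c<..<1} reflected_gain"
    using iff by blast
  then have "(gain has_integral integral {c<..<1} reflected_gain) {e<..}"
    using absolutely_integrable_on_def integrable_integral by metis
  moreover have "integral {c<..<1} reflected_gain = integral {c..1} reflected_gain"
    by (simp add: integral_open_interval_real)
  ultimately have "(gain has_integral integral {c..1} reflected_gain) {e<..}" by simp
  moreover have "(gain has_integral y) {e..} \<longleftrightarrow> (gain has_integral y) {e<..}" for y
    by (intro has_integral_spike_set_eq) (auto intro: negligible_subset[of "{e}"])
  ultimately show ?thesis unfolding c_def by simp
qed

lemma truncated_integral:
  assumes "0 < e" "e \<le> 1"
  shows "((\<lambda>t. loss t - gain t) has_integral (primitive e - integral {e / (1 + e)..e} reflected_gain)) {e..}"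
proof -
  have c: "0 < e / (1 + e)" "e / (1 + e) \<le> e" using assms by (auto simp: field_simps)
  have "(loss has_integral (integral {e..1} loss + 1 / (s * p))) ({e..1} \<union> {1..})"
    using loss_integrable_Icc[OF assms(1)] loss_has_integral_Ici
    by (intro has_integral_Un) (auto simp: integrable_integral intro: negligible_subset[of "{1}"])
  moreover have "{e..1} \<union> {1..} = {e..}" using assms by auto
  ultimately have L: "(loss has_integral (integral {e..1} loss + 1 / (s * p))) {e..}" by simp
  have "integral {e / (1 + e)..1} reflected_gain = integral {e / (1 + e)..e} reflected_gain + integral {e..1} reflected_gain"
    using assms c reflected_gain_integrable[of "e / (1 + e)"]
    by (intro Henstock_Kurzweil_Integration.integral_combine[symmetric]) auto
  moreover have "integral {e..1} reflected_gain - integral {e..1} loss = 1 / (s * p) - primitive e"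
    using integral_unique[OF diff_has_integral[OF assms]] 
      Henstock_Kurzweil_Integration.integral_diff[OF reflected_gain_integrable[OF assms] loss_integrable_Icc[OF assms(1)]]
    by simp
  ultimately have "integral {e..1} loss + 1 / (s * p) - integral {e / (1 + e)..1} reflected_gain
      = primitive e - integral {e / (1 + e)..e} reflected_gain" by simp
  then show ?thesis
    using has_integral_diff[OF L gain_has_integral[OF assms(1)]] by metis
qed

text \<open>The interval has length of order \<open>e ^ 2\<close>, and there the density is of order \<open>e powr (p - 2 - s p)\<close>. The
  product tends to \<open>0\<close> because \<open>s < 1\<close>.\<close>

lemma reflected_gain_small:
  assumes "0 < e" "e \<le> 1/2"
  shows "\<bar>integral {e / (1 + e)..e} reflected_gain\<bar> \<le> 8 * e powr (p - s * p)"
proof -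
  define c where "c = e / (1 + e)"
  have c: "0 < c" "c \<le> e" "e / 2 \<le> c" "e - c \<le> e^2" 
    using assms by (auto simp: c_def field_simps power2_eq_square)
  have q: "0 < p - s * p" using s_less p_greater by simp
  have bound: "reflected_gain v \<le> 8 * e powr (p - s * p) / e^2" if v: "c \<le> v" "v \<le> e" for v
  proof -
    have v': "0 < v" "v \<le> 1/2" "e / 2 \<le> v" using v c assms by auto
    have "loss v \<le> v powr (p - 1) * v powr (-1 - s * p)"
      unfolding loss_def using v' one_minus_powr_bounds[of v] p_greater
      by (intro mult_right_mono powr_mono2) (auto simp: max_def)
    also have "\<dots> = v powr (p - s * p) / v^2"
    proof -
      have "v powr (p - 1) * v powr (-1 - s * p) = v powr (p - s * p - 2)"
        by (simp add: powr_add[symmetric])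
      then show ?thesis using v' by (simp add: powr_diff)
    qed
    also have "\<dots> \<le> e powr (p - s * p) / (e/2)^2"
      using v v' q assms by (intro frac_le powr_mono2 power_mono) auto
    finally have 1: "loss v \<le> 4 * e powr (p - s * p) / e^2" by (simp add: power_divide mult.commute)
    have "(1 - v) powr (s - 1) \<le> (1 - v) powr (-1)" 
      using v' s_pos by (intro powr_mono') auto
    also have "\<dots> \<le> 2" using v' by (simp add: powr_minus field_simps)
    finally have "reflected_gain v \<le> (4 * e powr (p - s * p) / e^2) * 2"
      unfolding reflected_gain_def using 1 loss_nonneg[of v] by (intro mult_mono) auto
    then show ?thesis by simp
  qed
  have int: "reflected_gain integrable_on {c..e}"
    using integrable_on_subinterval[OF reflected_gain_integrable[of c]] c assms by auto
  have "integral {c..e} reflected_gain \<le> integral {c..e} (\<lambda>_. 8 * e powr (p - s * p) / e^2)"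
    using bound by (intro integral_le int) auto
  also have "\<dots> = (e - c) * (8 * e powr (p - s * p) / e^2)" using c by simp
  also have "\<dots> \<le> e^2 * (8 * e powr (p - s * p) / e^2)"
    using c by (intro mult_right_mono) auto
  finally have "integral {c..e} reflected_gain \<le> 8 * e powr (p - s * p)" using assms by simp
  moreover have "0 \<le> integral {c..e} reflected_gain"
    by (intro integral_nonneg int) (simp add: reflected_gain_def loss_nonneg)
  ultimately show ?thesis by (simp add: c_def)
qed

text \<open>Absolute integrability comes from a sign: the difference is nonnegative on
  \<open>(0, 1]\<close>, so the truncated integrals increase and their limit, which \<open>truncated_integral\<close> shows to be \<open>0\<close>, is
  the integral by monotone convergence.\<close>

proposition jump_cancellation:
  "((\<lambda>t. loss t - gain t) has_integral 0) {0<..}"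
  "(\<lambda>t. loss t - gain t) absolutely_integrable_on {0<..}"
proof -
  define a :: "nat \<Rightarrow> real" where "a n = 1 / real (n + 2)" for n
  have a: "0 < a n" "a n \<le> 1/2" "a (Suc n) \<le> a n" for n by (auto simp: a_def field_simps)
  have alim: "a \<longlonglongrightarrow> 0" 
    using LIMSEQ_ignore_initial_segment[OF lim_1_over_n, of 2] unfolding a_def by simp
  define x where "x n = primitive (a n) - integral {a n / (1 + a n)..a n} reflected_gain" for n
  have q: "0 < p - s * p" using s_less p_greater by simp
  have "x \<longlonglongrightarrow> 0"
  proof (rule Lim_null_comparison)
    show "\<forall>\<^sub>F n in sequentially. norm (x n) \<le> (1 / (s * p) + 8) * a n powr (p - s * p)"
    proof (intro always_eventually allI)
      fix n
      have "\<bar>x n\<bar> \<le> \<bar>primitive (a n)\<bar> + \<bar>integral {a n / (1 + a n)..a n} reflected_gain\<bar>"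
        unfolding x_def by simp
      also have "\<dots> \<le> a n powr (p - s * p) / (s * p) + 8 * a n powr (p - s * p)"
        using primitive_nonneg primitive_le[of "a n"] a(1,2)[of n] reflected_gain_small[of "a n"]
        by (intro add_mono) auto
      finally show "norm (x n) \<le> (1 / (s * p) + 8) * a n powr (p - s * p)" by (simp add: algebra_simps)
    qed
    have "(\<lambda>n. a n powr (p - s * p)) \<longlonglongrightarrow> 0 powr (p - s * p)"
      using alim q a by (intro tendsto_powr2) (auto simp: less_imp_le)
    then show "(\<lambda>n. (1 / (s * p) + 8) * a n powr (p - s * p)) \<longlonglongrightarrow> 0"
      using tendsto_mult_right_zero by auto
  qed
  define f where "f n t = (if t \<in> {a n..} then loss t - gain t else 0)" for n t
  show 1: "((\<lambda>t. loss t - gain t) has_integral 0) {0<..}"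
  proof (rule has_integral_monotone_convergence_increasing)
    show "(f n has_integral x n) {0<..}" for n
    proof -
      have "((\<lambda>t. loss t - gain t) has_integral x n) {a n..}"
        unfolding x_def using truncated_integral[of "a n"] a(1,2)[of n] by simp
      moreover have "{a n..} \<inter> {0<..} = {a n..}" using a(1)[of n] by auto
      ultimately show ?thesis
        unfolding f_def using has_integral_restrict_Int[of "{a n..}" "\<lambda>t. loss t - gain t" "x n" "{0<..}"]
        by simp
    qed
    show "f n t \<le> f (Suc n) t" if "t \<in> {0<..}" for n t
      using that a[of n] gain_le_loss[of t] by (auto simp: f_def)
    show "(\<lambda>n. f n t) \<longlonglongrightarrow> loss t - gain t" if "t \<in> {0<..}" for t
    proof (rule tendsto_eventually)
      have "\<forall>\<^sub>F n in sequentially. a n < t" using that order_tendstoD(2)[OF alim, of t] by simp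
      then show "\<forall>\<^sub>F n in sequentially. f n t = loss t - gain t"
        by eventually_elim (simp add: f_def)
    qed
  qed fact
  have i: "(\<lambda>t. loss t - gain t) integrable_on {0<..}" using 1 by blast
  have g1: "gain integrable_on {1..}" "loss integrable_on {1..}"
    using gain_has_integral[of 1] loss_has_integral_Ici by (auto simp: has_integral_integrable)
  have "gain absolutely_integrable_on {1..}" "loss absolutely_integrable_on {1..}"
    by (auto intro!: nonnegative_absolutely_integrable_1 g1 gain_nonneg loss_nonneg)
  then have A: "(\<lambda>t. loss t - gain t) absolutely_integrable_on {1..}"
    by (rule set_integral_diff(1)[rotated])
  have "(\<lambda>t. loss t - gain t) integrable_on {1..}"
    using A absolutely_integrable_on_def by blast
  then have "(\<lambda>t. loss t - gain t) integrable_on ({0<..} - {1..})"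
    using has_integral_setdiff[OF 1] unfolding integrable_on_def
    by (metis atLeast_subset_iff Diff_eq_empty_iff Ici_subset_Ioi_iff negligible_empty zero_less_one)
  then have "(\<lambda>t. loss t - gain t) absolutely_integrable_on ({0<..} - {1..})"
    by (rule nonnegative_absolutely_integrable_1) (use gain_le_loss in auto)
  then have "(\<lambda>t. loss t - gain t) absolutely_integrable_on (({0<..} - {1..}) \<union> {1..})"
    using A by (rule absolutely_integrable_Un)
  moreover have "({0<..} - {1..}) \<union> {1..} = {0::real<..}" by auto
  ultimately show "(\<lambda>t. loss t - gain t) absolutely_integrable_on {0<..}" by simp
qed

lemma jump_measurable [measurable]: "jump \<in> borel_measurable borel"
  unfolding jump_def[abs_def] by measurable

corollary symmetrized_jump_integral:
  defines "F \<equiv> \<lambda>t. indicator {0<..} t * ((jump t + jump (- t)) * t powr (-1 - s * p))"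
  shows "integrable lborel F" "integral\<^sup>L lborel F = 0"
proof -
  have F: "F t = indicator {0<..} t *\<^sub>R (loss t - gain t)" for t
    using jump_pos_neg[of t] by (simp add: F_def indicator_def)
  have meas: "F \<in> borel_measurable lborel" unfolding F_def by measurable
  have "integrable lebesgue F"
    using jump_cancellation(2) unfolding set_integrable_def F[abs_def] .
  then show int: "integrable lborel F"
    using integrable_completion[OF meas] by simp
  have "set_integrable lborel {0<..} (\<lambda>t. loss t - gain t)"
    using int unfolding set_integrable_def F[abs_def] .
  from set_borel_integral_eq_integral(2)[OF this]
  have "(LINT t:{0<..}|lborel. loss t - gain t) = 0"
    using integral_unique[OF jump_cancellation(1)] by simp
  then show "integral\<^sup>L lborel F = 0"
    unfolding set_lebesgue_integral_def F[abs_def] .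
qed

end

section \<open>The kernel and its pushforward along a direction\<close>

text \<open>The exterior of the ball is covered by the dyadic shells \<open>R j \<le> |y| < R (j + 1)\<close> with \<open>R j = r * 2 ^ j\<close>. On each the
  integral is at most the value of the kernel at the inner radius times the volume of the outer ball, and
  these bounds form a geometric series with ratio \<open>2 powr (- q)\<close>.\<close>

lemma powr_norm_integrable_outside_ball:
  fixes q r :: real
  assumes "0 < q" "0 < r"
  shows "set_integrable lborel (- ball 0 r) (\<lambda>y::'a::euclidean_space. norm y powr (- (DIM('a) + q)))"
proof -
  define w where "w y = norm y powr (- (DIM('a) + q))" for y :: 'a
  define R where "R j = r * 2 ^ j" for j :: nat
  have R: "0 < R j" for j using assms by (simp add: R_def)
  have [measurable]: "ball 0 (R j) \<in> sets (borel :: 'a measure)" for j by simp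
  define A where "A j = R j powr (- (DIM('a) + q))" for j
  have V: "emeasure lborel (ball 0 (R (Suc j)) :: 'a set) = ennreal (unit_ball_vol DIM('a) * R (Suc j) ^ DIM('a))" for j
    using R[of "Suc j"] by (simp add: emeasure_ball)
  have eq: "A j * (unit_ball_vol DIM('a) * R (Suc j) ^ DIM('a))
      = (unit_ball_vol DIM('a) * 2 ^ DIM('a) * r powr (- q)) * (2 powr (- q)) ^ j" for j
  proof -
    have "R j powr (- (DIM('a) + q)) * R j ^ DIM('a) = R j powr (- q)"
      using R[of j] by (simp add: powr_realpow[symmetric] powr_add[symmetric])
    also have "\<dots> = r powr (- q) * (2 powr (- q)) ^ j"
      using assms by (simp add: R_def powr_mult powr_realpow[symmetric] powr_powr mult.commute)
    moreover have "R (Suc j) ^ DIM('a) = 2 ^ DIM('a) * R j ^ DIM('a)"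
      by (simp add: R_def power_mult_distrib)
    ultimately show ?thesis by (simp add: A_def mult_ac)
  qed
  have "(\<integral>\<^sup>+y. ennreal (indicator (- ball 0 r) y * w y) \<partial>lborel)
      \<le> (\<integral>\<^sup>+y. (\<Sum>j. ennreal (A j) * indicator (ball 0 (R (Suc j)) :: 'a set) y) \<partial>lborel)"
  proof (rule nn_integral_mono)
    fix y :: 'a
    show "ennreal (indicator (- ball 0 r) y * w y) \<le> (\<Sum>j. ennreal (A j) * indicator (ball 0 (R (Suc j))) y)"
    proof (cases "r \<le> norm y")
      case True
      obtain n where n: "norm y / r < 2 ^ n" using real_arch_pow[of 2 "norm y / r"] by auto
      define m where "m = (LEAST m. norm y < R m)"
      have ex: "norm y < R n" using n assms by (simp add: R_def field_simps)
      have m: "norm y < R m" unfolding m_def by (rule LeastI[of _ n]) (rule ex)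
      have "m \<noteq> 0"
      proof
        assume "m = 0"
        with m True show False by (simp add: R_def)
      qed
      then obtain j where j: "m = Suc j" by (cases m) auto
      have "R j \<le> norm y" using not_less_Least[of j "\<lambda>m. norm y < R m"] j by (simp add: m_def)
      then have "w y \<le> A j" unfolding w_def A_def using R[of j] assms by (intro powr_mono2') auto
      then have "ennreal (indicator (- ball 0 r) y * w y) \<le> ennreal (A j) * indicator (ball 0 (R (Suc j))) y"
        using m j True by (simp add: ennreal_leI)
      also have "g j \<le> (\<Sum>j. g j)" for g :: "nat \<Rightarrow> ennreal"
        using sum_le_suminf[of g "{j}"] by simp
      finally show ?thesis .
    qed auto
  qed
  also have "\<dots> = (\<Sum>j. \<integral>\<^sup>+y. ennreal (A j) * indicator (ball 0 (R (Suc j)) :: 'a set) y \<partial>lborel)"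
    by (rule nn_integral_suminf) measurable
  also have "\<dots> = (\<Sum>j. ennreal (A j * (unit_ball_vol DIM('a) * R (Suc j) ^ DIM('a))))"
    using R by (simp add: nn_integral_cmult V ennreal_mult A_def less_imp_le)
  also have "\<dots> < \<infinity>"
    unfolding eq
    using assms by (subst suminf_ennreal2) (auto intro!: summable_mult summable_geometric 
        simp: less_top powr_less_one)
  finally have fin: "(\<integral>\<^sup>+y. ennreal (indicator (- ball 0 r) y * w y) \<partial>lborel) < \<infinity>" .
  have "integrable lborel (\<lambda>y. indicator (- ball 0 r) y * w y)"
    using fin by (intro integrableI_nonneg) (auto simp: w_def)
  then show ?thesis by (simp add: set_integrable_def w_def)
qed

lemma nn_integral_lborel_scaleR:
  fixes f :: "'a::euclidean_space \<Rightarrow> ennreal"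
  assumes [measurable]: "f \<in> borel_measurable borel" and "0 < c"
  shows "(\<integral>\<^sup>+y. f y \<partial>lborel) = ennreal (c ^ DIM('a)) * (\<integral>\<^sup>+y. f (c *\<^sub>R y) \<partial>lborel)"
  using assms(2)
  by (subst lborel_affine[of c 0])
     (auto simp: nn_integral_density nn_integral_distr nn_integral_cmult)

lemma lborel_integral_flip:
  fixes h :: "'a::euclidean_space \<Rightarrow> real"
  assumes [measurable]: "h \<in> borel_measurable borel"
  shows "integrable lborel (\<lambda>z. h (x - z)) \<longleftrightarrow> integrable lborel h"
    and "(LINT z|lborel. h (x - z)) = (LINT y|lborel. h y)"
proof -
  have D: "distr lborel borel (\<lambda>z. x - z) = (lborel :: 'a measure)"
    by (subst lborel_affine[of "-1" x]) (auto simp: density_1 one_ennreal_def[symmetric])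
  show "integrable lborel (\<lambda>z. h (x - z)) \<longleftrightarrow> integrable lborel h"
    using integrable_distr_eq[of "\<lambda>z. x - z" lborel borel h] D by simp
  show "(LINT z|lborel. h (x - z)) = (LINT y|lborel. h y)"
    using integral_distr[of "\<lambda>z. x - z" lborel borel h] D by simp
qed

lemma lborel_integral_reflect:
  fixes f :: "'a::euclidean_space \<Rightarrow> real"
  assumes "f \<in> borel_measurable borel"
  shows "integrable lborel f \<longleftrightarrow> integrable lborel (\<lambda>y. f (- y))"
    and "integral\<^sup>L lborel f = integral\<^sup>L lborel (\<lambda>y. f (- y))"
  using lborel_integral_flip[OF assms, of 0] by simp_all

lemma nn_integral_powr_tail:
  fixes q x :: real
  assumes "0 < q" "0 < x"
  shows "(\<integral>\<^sup>+t. ennreal (indicator {x<..} t * t powr (-1 - q)) \<partial>lborel) = ennreal (x powr (- q) / q)"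
proof -
  have e: "- 1 - q + 1 = - q" by simp
  have "((\<lambda>t. t powr (-1 - q)) has_integral x powr (- q) / q) {x..}"
    using has_integral_powr_to_inf[of "-1 - q" x] assms unfolding e by simp
  then have "(\<integral>\<^sup>+t. ennreal (indicator {x..} t * t powr (-1 - q)) \<partial>lborel) = ennreal (x powr (- q) / q)"
    using nn_integral_has_integral_lebesgue[of "{x..}" "\<lambda>t. t powr (-1 - q)" "x powr (- q) / q"] by simp
  moreover have "(\<integral>\<^sup>+t. ennreal (indicator {x..} t * t powr (-1 - q)) \<partial>lborel)
     = (\<integral>\<^sup>+t. ennreal (indicator {x<..} t * t powr (-1 - q)) \<partial>lborel)"
    using AE_lborel_singleton[of x] by (intro nn_integral_cong_AE) (auto elim!: eventually_mono simp: indicator_def)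
  ultimately show ?thesis by simp
qed

text \<open>A measure on the positive axis is determined by its tails. Substituting \<open>x y\<close> for \<open>y\<close> shows that the kernel measure
  of the half-space \<open>b \<bullet> y > x\<close> is \<open>x powr (- q)\<close> times that of \<open>b \<bullet> y > 1\<close>, which is finite as this half-space misses
  a ball around \<open>0\<close>. The total mass is infinite, so uniqueness is applied on \<open>b \<bullet> y > r\<close> first, and then
  \<open>r\<close> tends to \<open>0\<close>.\<close>

proposition ridge_pushforward:
  fixes b :: "'a::euclidean_space" and q :: real
  assumes "b \<noteq> 0" "0 < q"
  obtains K where "0 \<le> K"
    "distr (density lborel (\<lambda>y. ennreal (indicator {y. 0 < b \<bullet> y} y * norm y powr (- (DIM('a) + q)))))
       borel (\<lambda>y. b \<bullet> y)
     = density lborel (\<lambda>t. ennreal (K * (indicator {0<..} t * t powr (-1 - q))))"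
proof -
  define w where "w y = norm y powr (- (DIM('a) + q))" for y :: 'a
  have [measurable]: "w \<in> borel_measurable borel" unfolding w_def[abs_def] by measurable
  define T where "T x = (\<integral>\<^sup>+y. ennreal (indicator {y. x < b \<bullet> y} y * w y) \<partial>lborel)" for x
  have T_scale: "T x = ennreal (x powr (- q)) * T 1" if x: "0 < x" for x
  proof -
    have "T x = ennreal (x ^ DIM('a)) * (\<integral>\<^sup>+y. ennreal (indicator {y. x < b \<bullet> y} (x *\<^sub>R y) * w (x *\<^sub>R y)) \<partial>lborel)"
      unfolding T_def by (rule nn_integral_lborel_scaleR) (use x in auto)
    also have "\<dots> = ennreal (x ^ DIM('a)) * (\<integral>\<^sup>+y. ennreal (x powr (- (DIM('a) + q))) * ennreal (indicator {y. 1 < b \<bullet> y} y * w y) \<partial>lborel)"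
      using x by (intro arg_cong2[where f = "(*)"] nn_integral_cong refl)
        (auto simp: indicator_def w_def powr_mult ennreal_mult'[symmetric])
    also have "\<dots> = (ennreal (x ^ DIM('a)) * ennreal (x powr (- (DIM('a) + q)))) * T 1"
      by (simp add: nn_integral_cmult T_def mult.assoc)
    also have "ennreal (x ^ DIM('a)) * ennreal (x powr (- (DIM('a) + q))) = ennreal (x powr (- q))"
      using x by (simp add: ennreal_mult'[symmetric] powr_realpow[symmetric] powr_add[symmetric])
    finally show ?thesis .
  qed
  have T_fin: "T 1 < \<infinity>"
  proof -
    have "integrable lborel (\<lambda>y. indicator (- ball 0 (1 / norm b)) y * w y)"
      using powr_norm_integrable_outside_ball[of q "1 / norm b", where 'a='a] assms
      by (simp add: set_integrable_def w_def)
    then have "(\<integral>\<^sup>+y. ennreal (indicator (- ball 0 (1 / norm b)) y * w y) \<partial>lborel) < \<infinity>"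
      by (subst (asm) integrable_iff_bounded) (simp add: w_def abs_mult)
    moreover have "T 1 \<le> (\<integral>\<^sup>+y. ennreal (indicator (- ball 0 (1 / norm b)) y * w y) \<partial>lborel)"
      unfolding T_def
    proof (intro nn_integral_mono ennreal_leI mult_right_mono)
      fix y :: 'a
      have "1 / norm b \<le> norm y" if "1 < b \<bullet> y"
        using that norm_cauchy_schwarz[of b y] assms by (simp add: field_simps)
      then show "indicator {y. 1 < b \<bullet> y} y \<le> (indicator (- ball 0 (1 / norm b)) y :: real)"
        by (auto simp: indicator_def)
    qed (simp add: w_def)
    ultimately show ?thesis by (rule le_less_trans[rotated])
  qed
  define K where "K = enn2real (T 1) * q"
  have K: "0 \<le> K" using assms by (simp add: K_def)
  define M where "M r = distr (density lborel (\<lambda>y. ennreal (indicator {y. r < b \<bullet> y} y * w y))) borel (\<lambda>y. b \<bullet> y)" for r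
  define N where "N r = density lborel (\<lambda>t. ennreal (K * (indicator {r<..} t * t powr (-1 - q))))" for r
  have T_eq: "T x = ennreal (K * (x powr (- q) / q))" if "0 < x" for x
    using T_scale[OF that] T_fin assms by (simp add: K_def ennreal_mult' mult.commute)
  have emM': "emeasure (M r) A = (\<integral>\<^sup>+y. ennreal (w y) * indicator A (b \<bullet> y) * indicator {r<..} (b \<bullet> y) \<partial>lborel)"
    if [measurable]: "A \<in> sets borel" for A r
  proof -
    have "(\<lambda>y. b \<bullet> y) -` A \<in> sets borel" by (rule measurable_sets_borel) measurable
    then show ?thesis unfolding M_def
      by (auto simp: emeasure_distr emeasure_density indicator_def intro!: nn_integral_cong)
  qed
  have emM: "emeasure (M r) {x<..} = T (max x r)" for r x
    unfolding T_def by (subst emM') (auto simp: indicator_def intro!: nn_integral_cong)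
  have emN: "emeasure (N r) {x<..} = ennreal (K * (max x r powr (- q) / q))" if "0 < r" for r x
  proof -
    have "emeasure (N r) {x<..} = (\<integral>\<^sup>+t. ennreal K * ennreal (indicator {max x r<..} t * t powr (-1 - q)) \<partial>lborel)"
      unfolding N_def using K
      by (auto simp: emeasure_density indicator_def ennreal_mult'[symmetric] intro!: nn_integral_cong)
    also have "\<dots> = ennreal K * ennreal (max x r powr (- q) / q)"
      using nn_integral_powr_tail[of q "max x r"] that assms by (subst nn_integral_cmult) auto
    finally show ?thesis using K by (simp add: ennreal_mult'[symmetric])
  qed
  have MN: "M r = N r" if "0 < r" for r
  proof (rule measure_eqI_lessThan)
    show "emeasure (M r) {x<..} < \<infinity>" "emeasure (M r) {x<..} = emeasure (N r) {x<..}" for x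
      using T_eq[of "max x r"] that by (auto simp: emM emN[OF that])
  qed (auto simp: M_def N_def)
  define a :: "nat \<Rightarrow> real" where "a n = 1 / real (Suc n)" for n
  have a: "0 < a n" "a (Suc n) \<le> a n" for n by (auto simp: a_def field_simps)
  have sup: "(SUP n. (indicator {a n<..} x :: ennreal)) = indicator {0<..} x" for x
  proof (cases "0 < x")
    case True
    then obtain n where "a n < x" using nat_approx_posE[of x] by (auto simp: a_def)
    then have "(1::ennreal) \<le> (SUP n. indicator {a n<..} x)" by (intro SUP_upper2[of n]) auto
    moreover have "(SUP n. (indicator {a n<..} x :: ennreal)) \<le> 1" by (intro SUP_least) (auto simp: indicator_def)
    ultimately show ?thesis using True by (auto intro: antisym)
  next
    case False
    then have "indicator {a n<..} x = (0::ennreal)" for n using a(1)[of n] by (auto simp: indicator_def)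
    then show ?thesis using False by simp
  qed
  have inc: "incseq (\<lambda>n y. f y * indicator {a n<..} (g y))" for f :: "'b \<Rightarrow> ennreal" and g
    using a by (intro incseq_SucI le_funI mult_left_mono) (auto simp: indicator_def intro: le_less_trans)
  have "M 0 = N 0"
  proof (rule measure_eqI)
    show "sets (M 0) = sets (N 0)" by (simp add: M_def N_def)
    fix A assume "A \<in> sets (M 0)"
    then have [measurable]: "A \<in> sets borel" by (simp add: M_def)
    have "emeasure (M 0) A = (\<integral>\<^sup>+y. (SUP n. (ennreal (w y) * indicator A (b \<bullet> y)) * indicator {a n<..} (b \<bullet> y)) \<partial>lborel)"
      by (simp only: SUP_mult_left_ennreal[symmetric] sup emM'[OF \<open>A \<in> sets borel\<close>])
    also have "\<dots> = (SUP n. \<integral>\<^sup>+y. (ennreal (w y) * indicator A (b \<bullet> y)) * indicator {a n<..} (b \<bullet> y) \<partial>lborel)"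
      by (intro nn_integral_monotone_convergence_SUP inc) measurable
    also have "\<dots> = (SUP n. emeasure (M (a n)) A)"
      by (simp only: emM'[OF \<open>A \<in> sets borel\<close>])
    also have "\<dots> = (SUP n. emeasure (N (a n)) A)" using MN a by simp
    also have "\<dots> = (SUP n. \<integral>\<^sup>+t. (ennreal (K * t powr (-1 - q)) * indicator A t) * indicator {a n<..} t \<partial>lborel)"
      unfolding N_def
      by (auto simp: emeasure_density indicator_def intro!: SUP_cong nn_integral_cong)
    also have "\<dots> = (\<integral>\<^sup>+t. (SUP n. (ennreal (K * t powr (-1 - q)) * indicator A t) * indicator {a n<..} t) \<partial>lborel)"
      by (intro nn_integral_monotone_convergence_SUP[symmetric] inc) measurable
    also have "\<dots> = emeasure (N 0) A"
      unfolding N_def SUP_mult_left_ennreal[symmetric] sup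
      by (auto simp: emeasure_density indicator_def intro!: nn_integral_cong)
    finally show "emeasure (M 0) A = emeasure (N 0) A" .
  qed
  then show ?thesis using that[of K] K unfolding M_def N_def w_def by simp
qed


section \<open>Truncated plane waves are p-harmonic\<close>

context frac_exponents
begin

lemma jump_growth: "\<bar>jump t\<bar> \<le> (1 + \<bar>t\<bar>) powr (s * (p - 1))"
proof -
  define m where "m = max 0 (1 + t) powr s"
  have "m \<le> (1 + \<bar>t\<bar>) powr s" "1 \<le> (1 + \<bar>t\<bar>) powr s" "0 \<le> m"
    unfolding m_def using s_pos by (auto intro!: powr_mono2 ge_one_powr_ge_zero)
  then have "\<bar>1 - m\<bar> \<le> (1 + \<bar>t\<bar>) powr s" by auto
  then have "\<bar>1 - m\<bar> powr (p - 1) \<le> ((1 + \<bar>t\<bar>) powr s) powr (p - 1)"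
    using p_greater by (intro powr_mono2) auto
  moreover have "\<bar>jump t\<bar> = \<bar>1 - m\<bar> powr (p - 1)"
  proof (cases "m = 1")
    case False
    then have "\<bar>1 - m\<bar> powr (p - 2) * \<bar>1 - m\<bar> = \<bar>1 - m\<bar> powr (p - 1)"
      using powr_add[of "\<bar>1 - m\<bar>" "p - 2" 1] by simp
    then show ?thesis using False by (simp add: jump_def m_def[symmetric] abs_mult)
  qed (simp add: jump_def m_def[symmetric])
  ultimately show ?thesis by (simp add: powr_powr)
qed

text \<open>By \<open>jump_growth\<close>, the numerator is of order \<open>|y| powr (s (p - 1))\<close> at infinity, which leaves a kernel
  \<open>|y| powr (-d - s)\<close>.\<close>

lemma jump_ridge_integrable:
  fixes b :: "'a::euclidean_space"
  assumes "0 < r"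
  shows "set_integrable lborel (- ball 0 r) (\<lambda>y. jump (b \<bullet> y) * norm y powr (- (DIM('a) + s * p)))"
  unfolding set_integrable_def
proof (rule Bochner_Integration.integrable_bound)
  define C where "C = (1 / r + norm b) powr (s * (p - 1))"
  show "integrable lborel (\<lambda>y. C * (indicator (- ball 0 r) y *\<^sub>R norm (y::'a) powr (- (DIM('a) + s))))"
    using powr_norm_integrable_outside_ball[of s r, where 'a='a] s_pos assms
    by (intro integrable_mult_right) (simp add: set_integrable_def)
  show "AE y in lborel. norm (indicat_real (- ball 0 r) y *\<^sub>R (jump (b \<bullet> y) * norm y powr (- (DIM('a) + s * p))))
     \<le> norm (C * (indicator (- ball 0 r) y *\<^sub>R norm (y::'a) powr (- (DIM('a) + s))))"
  proof (intro always_eventually allI)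
    fix y :: 'a
    show "norm (indicat_real (- ball 0 r) y *\<^sub>R (jump (b \<bullet> y) * norm y powr (- (DIM('a) + s * p))))
     \<le> norm (C * (indicator (- ball 0 r) y *\<^sub>R norm (y::'a) powr (- (DIM('a) + s))))"
    proof (cases "r \<le> norm y")
      case True
      have "1 + \<bar>b \<bullet> y\<bar> \<le> norm y / r + norm b * norm y"
        using Cauchy_Schwarz_ineq2[of b y] True assms by (intro add_mono) auto
      also have "\<dots> = (1 / r + norm b) * norm y" by (simp add: algebra_simps)
      finally have "\<bar>jump (b \<bullet> y)\<bar> \<le> ((1 / r + norm b) * norm y) powr (s * (p - 1))"
        using s_pos p_greater by (intro order_trans[OF jump_growth] powr_mono2) auto
      also have "\<dots> = C * norm y powr (s * (p - 1))"
        unfolding C_def by (rule powr_mult)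
      finally have "\<bar>jump (b \<bullet> y)\<bar> * norm y powr (- (DIM('a) + s * p))
        \<le> C * norm y powr (s * (p - 1)) * norm y powr (- (DIM('a) + s * p))"
        by (rule mult_right_mono) simp
      also have "\<dots> = C * norm y powr (- (DIM('a) + s))"
        by (simp add: mult.assoc powr_add[symmetric] algebra_simps)
      finally show ?thesis using True by (simp add: abs_mult C_def)
    qed simp
  qed
qed measurable

text \<open>The hyperplane \<open>b \<bullet> y = 0\<close> contributes nothing since \<open>jump 0 = 0\<close>; the reflection \<open>y \<mapsto> -y\<close> moves the part with
  \<open>b \<bullet> y < 0\<close> to the half-space \<open>b \<bullet> y > 0\<close>.\<close>

lemma jump_ridge_integral_symmetrized:
  fixes b :: "'a::euclidean_space"
  assumes "0 < r"
  defines "w \<equiv> \<lambda>y::'a. norm y powr (- (DIM('a) + s * p))"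
  shows "(LINT y:- ball 0 r|lborel. jump (b \<bullet> y) * w y)
    = (LINT y|lborel. indicator (- ball 0 r) y * (indicator {y. 0 < b \<bullet> y} y * w y * (jump (b \<bullet> y) + jump (- (b \<bullet> y)))))"
proof -
  have [measurable]: "w \<in> borel_measurable borel" unfolding w_def by measurable
  define f where "f y = indicator (- ball 0 r) y * (jump (b \<bullet> y) * w y)" for y
  define P where "P = {y. 0 < b \<bullet> y}"
  define N where "N = {y. b \<bullet> y < 0}"
  have [measurable]: "f \<in> borel_measurable borel" "P \<in> sets borel" "N \<in> sets borel"
    unfolding f_def[abs_def] P_def N_def by measurable
  have f: "integrable lborel f"
    using jump_ridge_integrable[OF assms(1), of b] unfolding set_integrable_def f_def w_def by simp
  have fP: "integrable lborel (\<lambda>y. indicator P y * f y)" "integrable lborel (\<lambda>y. indicator N y * f y)"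
    using f by (auto intro: integrable_real_mult_indicator simp: mult.commute)
  have "jump 0 = 0" by (simp add: jump_def)
  then have "f y = indicator P y * f y + indicator N y * f y" for y
    by (auto simp: f_def P_def N_def indicator_def)
  then have "integral\<^sup>L lborel f = (LINT y|lborel. indicator P y * f y + indicator N y * f y)"
    by simp
  also have "\<dots> = (LINT y|lborel. indicator P y * f y) + (LINT y|lborel. indicator N y * f y)"
    using fP by (rule Bochner_Integration.integral_add)
  also have "(LINT y|lborel. indicator N y * f y) = (LINT y|lborel. indicator N (- y) * f (- y))"
    by (simp add: lborel_integral_reflect(2)[of "\<lambda>y. indicator N y * f y"])
  also have "(LINT y|lborel. indicator P y * f y) + (LINT y|lborel. indicator N (- y) * f (- y))
    = (LINT y|lborel. indicator P y * f y + indicator N (- y) * f (- y))"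
    using fP lborel_integral_reflect(1)[of "\<lambda>y. indicator N y * f y"]
    by (intro Bochner_Integration.integral_add[symmetric]) auto
  also have "\<dots> = (LINT y|lborel. indicator (- ball 0 r) y * (indicator P y * w y * (jump (b \<bullet> y) + jump (- (b \<bullet> y)))))"
    by (intro Bochner_Integration.integral_cong refl)
      (auto simp: f_def P_def N_def w_def indicator_def algebra_simps)
  finally show ?thesis
    by (simp add: set_lebesgue_integral_def f_def[abs_def] P_def)
qed

proposition jump_ridge_principal_value:
  fixes b :: "'a::euclidean_space"
  assumes "b \<noteq> 0"
  shows "((\<lambda>r. LINT y:- ball 0 r|lborel. jump (b \<bullet> y) * norm y powr (- (DIM('a) + s * p))) \<longlongrightarrow> 0) (at_right 0)"
proof -
  have q: "0 < s * p" using s_pos p_greater by simp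
  define w where "w y = norm y powr (- (DIM('a) + s * p))" for y :: 'a
  have [measurable]: "w \<in> borel_measurable borel" unfolding w_def[abs_def] by measurable
  define H where "H t = jump t + jump (- t)" for t
  have [measurable]: "H \<in> borel_measurable borel" unfolding H_def[abs_def] by measurable
  define G where "G y = indicator {y. 0 < b \<bullet> y} y * w y * H (b \<bullet> y)" for y
  have [measurable]: "G \<in> borel_measurable borel" unfolding G_def[abs_def] by measurable
  obtain K where K: "0 \<le> K"
    "distr (density lborel (\<lambda>y. ennreal (indicator {y. 0 < b \<bullet> y} y * w y))) borel (\<lambda>y. b \<bullet> y)
     = density lborel (\<lambda>t. ennreal (K * (indicator {0<..} t * t powr (-1 - s * p))))" (is "?M = ?N")
    unfolding w_def using ridge_pushforward[OF assms q] by blast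
  have HN: "K * (indicator {0<..} t * t powr (-1 - s * p)) * H t
      = K * (indicator {0<..} t * ((jump t + jump (- t)) * t powr (-1 - s * p)))" for t
    by (simp add: H_def)
  have "integrable ?N H"
    using symmetrized_jump_integral(1) K(1)
    by (subst integrable_density) (auto simp: HN)
  then have "integrable ?M H" using K(2) by simp
  then have G_int: "integrable lborel G"
    by (subst (asm) integrable_distr_eq) (auto simp: integrable_density w_def G_def[abs_def])
  have "integral\<^sup>L lborel G = integral\<^sup>L ?M H"
    by (subst integral_distr) (auto simp: integral_density w_def G_def[abs_def])
  also have "\<dots> = integral\<^sup>L ?N H" using K(2) by simp
  also have "\<dots> = 0"
    using symmetrized_jump_integral(2) K(1)
    by (subst integral_density) (auto simp: HN)
  finally have G0: "integral\<^sup>L lborel G = 0" .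
  have "((\<lambda>r. LINT y|lborel. indicator (- ball 0 r) y * G y) \<longlongrightarrow> 0) (at_right 0)"
  proof (rule tendsto_at_right_sequentially[of 0 1])
    fix S :: "nat \<Rightarrow> real"
    assume S: "\<And>n. 0 < S n" "S \<longlonglongrightarrow> 0"
    have "(\<lambda>n. LINT y|lborel. indicator (- ball 0 (S n)) y * G y) \<longlonglongrightarrow> integral\<^sup>L lborel G"
    proof (rule integral_dominated_convergence)
      show "integrable lborel (\<lambda>y. \<bar>G y\<bar>)" using G_int by simp
      show "AE y in lborel. (\<lambda>n. indicator (- ball 0 (S n)) y * G y) \<longlonglongrightarrow> G y"
      proof (intro always_eventually allI)
        fix y
        show "(\<lambda>n. indicator (- ball 0 (S n)) y * G y) \<longlonglongrightarrow> G y"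
        proof (cases "y = 0")
          case True
          then show ?thesis by (simp add: G_def)
        next
          case False
          then have "\<forall>\<^sub>F n in sequentially. S n < norm y"
            using order_tendstoD(2)[OF S(2), of "norm y"] by simp
          then have "\<forall>\<^sub>F n in sequentially. indicator (- ball 0 (S n)) y * G y = G y"
            by eventually_elim simp
          then show ?thesis by (rule tendsto_eventually)
        qed
      qed
    qed (auto simp: indicator_def)
    then show "(\<lambda>n. LINT y|lborel. indicator (- ball 0 (S n)) y * G y) \<longlonglongrightarrow> 0" using G0 by simp
  qed simp
  then show ?thesis
  proof (rule Lim_transform_eventually)
    show "\<forall>\<^sub>F r in at_right 0. (LINT y|lborel. indicator (- ball 0 r) y * G y)
       = (LINT y:- ball 0 r|lborel. jump (b \<bullet> y) * norm y powr (- (DIM('a) + s * p)))"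
      using eventually_at_right_less[of 0]
      by eventually_elim (simp only: jump_ridge_integral_symmetrized G_def H_def w_def)
  qed
qed

text \<open>Homogeneity: with \<open>c = 1 + a \<bullet> x\<close>, the increments of the plane wave at \<open>x\<close> are \<open>c powr s\<close> times those
  of the profile, so the integrand is \<open>c powr (s (p - 1))\<close> times the one already treated.\<close>

theorem plane_wave_has_zero_laplacian:
  fixes a x :: "'a::euclidean_space"
  assumes "0 < 1 + a \<bullet> x"
  shows "has_frac_p_laplacian s p (\<lambda>x. max 0 (1 + a \<bullet> x) powr s) x 0"
proof (cases "a = 0")
  case True
  then show ?thesis by (simp add: has_frac_p_laplacian_def frac_p_integrand_def[abs_def] set_integrable_def)
next
  case False
  define c where "c = 1 + a \<bullet> x"
  define b where "b = (1 / c) *\<^sub>R a"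
  have c: "0 < c" using assms by (simp add: c_def)
  have b: "b \<noteq> 0" using False c by (simp add: b_def)
  define u where "u x = max 0 (1 + a \<bullet> x) powr s" for x
  have "frac_p_integrand s p u x y
      = c powr (s * (p - 1)) * (jump (b \<bullet> y) * norm y powr (- (DIM('a) + s * p)))" for y
  proof -
    have "c * (b \<bullet> y) = a \<bullet> y" using c by (simp add: b_def)
    then have "1 + a \<bullet> (x + y) = c * (1 + b \<bullet> y)"
      by (simp add: c_def inner_add_right algebra_simps)
    then have "max 0 (1 + a \<bullet> (x + y)) = c * max 0 (1 + b \<bullet> y)"
      using c by (simp add: max_mult_distrib_left)
    then have "u (x + y) = c powr s * max 0 (1 + b \<bullet> y) powr s"
      by (simp add: u_def powr_mult)
    moreover have "u x = c powr s" using c by (simp add: u_def c_def)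
    ultimately have *: "u x - u (x + y) = c powr s * (1 - max 0 (1 + b \<bullet> y) powr s)"
      by (simp add: algebra_simps)
    have "\<bar>u x - u (x + y)\<bar> powr (p - 2) * (u x - u (x + y))
      = (c powr s) powr (p - 2) * c powr s * jump (b \<bullet> y)"
      unfolding * jump_def by (simp add: abs_mult powr_mult)
    also have "(c powr s) powr (p - 2) * c powr s = c powr (s * (p - 1))"
      by (simp add: powr_powr powr_add[symmetric] algebra_simps)
    finally show ?thesis
      unfolding frac_p_integrand_def powr_minus_divide by simp
  qed
  then have I: "frac_p_integrand s p u x
      = (\<lambda>y. c powr (s * (p - 1)) * (jump (b \<bullet> y) * norm y powr (- (DIM('a) + s * p))))"
    by auto
  have "has_frac_p_laplacian s p u x 0"
    unfolding has_frac_p_laplacian_def I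
  proof (intro conjI allI impI)
    show "set_integrable lborel (- ball 0 r) (\<lambda>y. c powr (s * (p - 1)) * (jump (b \<bullet> y) * norm y powr (- (DIM('a) + s * p))))"
      if "0 < r" for r :: real
      using jump_ridge_integrable[OF that, of b] by (rule set_integrable_mult_right)
    show "((\<lambda>r. LINT y:- ball 0 r|lborel. c powr (s * (p - 1)) * (jump (b \<bullet> y) * norm y powr (- (DIM('a) + s * p)))) \<longlongrightarrow> 0) (at_right 0)"
      unfolding set_integral_mult_right
      using tendsto_mult_right_zero[OF jump_ridge_principal_value[OF b]] .
  qed
  then show ?thesis unfolding u_def[abs_def] .
qed

end

section \<open>Calculus of iterated partial derivatives\<close>

lemma iter_partial_simps [simp]:
  "iter_partial [] \<phi> = \<phi>"
  "iter_partial (b # bs) \<phi> = partial_deriv b (iter_partial bs \<phi>)"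
  "iter_partial (bs @ [b]) \<phi> = iter_partial bs (partial_deriv b \<phi>)"
  by (simp_all add: iter_partial_def)

lemma partial_deriv_eqI:
  assumes "((\<lambda>t. \<phi> (x + t *\<^sub>R b)) has_real_derivative D) (at 0)"
  shows "partially_differentiable_at b \<phi> x" "partial_deriv b \<phi> x = D"
  using assms DERIV_imp_deriv
  by (auto simp: partially_differentiable_at_def partial_deriv_def field_differentiable_def)

lemma partially_differentiable_atD:
  "partially_differentiable_at b \<phi> x \<Longrightarrow>
    ((\<lambda>t. \<phi> (x + t *\<^sub>R b)) has_real_derivative partial_deriv b \<phi> x) (at 0)"
  by (simp add: partially_differentiable_at_def partial_deriv_def field_differentiable_derivI)

lemma eventually_line_in_open:
  fixes x b :: "'a::euclidean_space"
  assumes "open U" "x \<in> U"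
  shows "\<forall>\<^sub>F t in nhds (0::real). x + t *\<^sub>R b \<in> U"
proof -
  have "((\<lambda>t::real. x + t *\<^sub>R b) \<longlongrightarrow> x + 0 *\<^sub>R b) (nhds 0)"
    by (intro tendsto_intros filterlim_ident)
  then show ?thesis using topological_tendstoD[of _ x "nhds 0" U] assms by simp
qed

lemma has_partial_cong:
  fixes x b :: "'a::euclidean_space"
  assumes "open U" "x \<in> U" "\<And>y. y \<in> U \<Longrightarrow> \<phi> y = \<psi> y"
  shows "((\<lambda>t. \<phi> (x + t *\<^sub>R b)) has_real_derivative D) (at 0) \<longleftrightarrow>
    ((\<lambda>t. \<psi> (x + t *\<^sub>R b)) has_real_derivative D) (at 0)"
  using eventually_line_in_open[OF assms(1,2), of b] assms
  by (intro DERIV_cong_ev) (auto elim!: eventually_mono)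

lemma partial_deriv_cong:
  fixes x b :: "'a::euclidean_space"
  assumes "open U" "x \<in> U" "\<And>y. y \<in> U \<Longrightarrow> \<phi> y = \<psi> y"
  shows "partially_differentiable_at b \<phi> x \<longleftrightarrow> partially_differentiable_at b \<psi> x"
    "partial_deriv b \<phi> x = partial_deriv b \<psi> x"
  using has_partial_cong[OF assms(1,2), of \<phi> \<psi> b] assms(3)
  by (simp_all add: partially_differentiable_at_def partial_deriv_def field_differentiable_def deriv_def)

lemma iter_partial_cong:
  fixes x :: "'a::euclidean_space"
  assumes "open U" "x \<in> U" "\<And>y. y \<in> U \<Longrightarrow> \<phi> y = \<psi> y"
  shows "iter_partial bs \<phi> x = iter_partial bs \<psi> x"
  using assms(2)
proof (induction bs arbitrary: x)
  case (Cons b bs)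
  then show ?case unfolding iter_partial_simps by (intro partial_deriv_cong(2)[OF assms(1)]) auto
qed (use assms in simp)

lemma Ck_on_cong:
  fixes U :: "'a::euclidean_space set"
  assumes "open U" "\<And>y. y \<in> U \<Longrightarrow> \<phi> y = \<psi> y"
  shows "\<phi> \<in> Ck_on k U \<longleftrightarrow> \<psi> \<in> Ck_on k U"
proof -
  have "continuous_on U (iter_partial bs \<phi>) \<longleftrightarrow> continuous_on U (iter_partial bs \<psi>)" for bs
    by (intro continuous_on_cong refl iter_partial_cong[OF assms(1) _ assms(2)])
  moreover have "partially_differentiable_at b (iter_partial bs \<phi>) x \<longleftrightarrow> partially_differentiable_at b (iter_partial bs \<psi>) x"
    if "x \<in> U" for b bs x
    by (intro partial_deriv_cong(1)[OF assms(1) that] iter_partial_cong[OF assms(1) _ assms(2)])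
  ultimately show ?thesis by (simp add: Ck_on_def)
qed

text \<open>The recursion on the innermost derivative; the definition of \<^const>\<open>iter_partial\<close> recurses on the outermost
  one. Regularity of products and of powers of positive parts is proved along it.\<close>

lemma Ck_on_Suc:
  "\<phi> \<in> Ck_on (Suc k) U \<longleftrightarrow> continuous_on U \<phi> \<and>
    (\<forall>b\<in>Basis. (\<forall>x\<in>U. partially_differentiable_at b \<phi> x) \<and> partial_deriv b \<phi> \<in> Ck_on k U)"
  (is "?L \<longleftrightarrow> ?R")
proof
  assume L: ?L
  then have *: "continuous_on U (iter_partial bs \<phi>)"
    "length bs < Suc k \<Longrightarrow> b \<in> Basis \<Longrightarrow> x \<in> U \<Longrightarrow> partially_differentiable_at b (iter_partial bs \<phi>) x"
    if "set bs \<subseteq> Basis" "length bs \<le> Suc k" for bs b x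
    using that unfolding Ck_on_def by auto
  have "partial_deriv b \<phi> \<in> Ck_on k U" if "b \<in> Basis" for b
    unfolding Ck_on_def using *[of "_ @ [b]"] that by auto
  then show ?R using *[of "[]"] by auto
next
  assume R: ?R
  show ?L
    unfolding Ck_on_def
  proof (intro CollectI allI impI)
    fix bs :: "'a list"
    assume bs: "set bs \<subseteq> Basis \<and> length bs \<le> Suc k"
    show "continuous_on U (iter_partial bs \<phi>) \<and>
      (length bs < Suc k \<longrightarrow> (\<forall>b\<in>Basis. \<forall>x\<in>U. partially_differentiable_at b (iter_partial bs \<phi>) x))"
    proof (cases bs rule: rev_cases)
      case Nil
      then show ?thesis using R by simp
    next
      case (snoc cs c)
      then have "partial_deriv c \<phi> \<in> Ck_on k U" "set cs \<subseteq> Basis" "length cs \<le> k" using R bs by auto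
      then show ?thesis unfolding Ck_on_def snoc by simp
    qed
  qed
qed

lemma Ck_on_0: "\<phi> \<in> Ck_on 0 U \<longleftrightarrow> continuous_on U \<phi>"
  by (auto simp: Ck_on_def)

lemma Ck_on_Suc_imp: "\<phi> \<in> Ck_on (Suc k) U \<Longrightarrow> \<phi> \<in> Ck_on k U"
  by (auto simp: Ck_on_def)

lemma Ck_on_subset: "\<phi> \<in> Ck_on k U \<Longrightarrow> V \<subseteq> U \<Longrightarrow> \<phi> \<in> Ck_on k V"
  unfolding Ck_on_def by (blast intro: continuous_on_subset)

lemma Ck_on_Un:
  "open U \<Longrightarrow> open V \<Longrightarrow> \<phi> \<in> Ck_on k U \<Longrightarrow> \<phi> \<in> Ck_on k V \<Longrightarrow> \<phi> \<in> Ck_on k (U \<union> V)"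
  unfolding Ck_on_def by (auto intro: continuous_on_open_Un)

lemma Ck_on_iter_continuous:
  "\<phi> \<in> Ck_on k U \<Longrightarrow> set bs \<subseteq> Basis \<Longrightarrow> length bs \<le> k \<Longrightarrow> continuous_on U (iter_partial bs \<phi>)"
  by (simp add: Ck_on_def)

lemma Ck_on_iter_has_partial:
  "\<phi> \<in> Ck_on k U \<Longrightarrow> set bs \<subseteq> Basis \<Longrightarrow> length bs < k \<Longrightarrow> b \<in> Basis \<Longrightarrow> x \<in> U \<Longrightarrow>
   ((\<lambda>t. iter_partial bs \<phi> (x + t *\<^sub>R b)) has_real_derivative iter_partial (b # bs) \<phi> x) (at 0)"
  by (auto simp: Ck_on_def intro!: partially_differentiable_atD)

lemma Ck_on_SucI:
  fixes U :: "'a::euclidean_space set"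
  assumes U: "open U" and "continuous_on U \<phi>"
    and D: "\<And>b x. b \<in> Basis \<Longrightarrow> x \<in> U \<Longrightarrow> ((\<lambda>t. \<phi> (x + t *\<^sub>R b)) has_real_derivative \<psi> b x) (at 0)"
    and "\<And>b. b \<in> Basis \<Longrightarrow> \<psi> b \<in> Ck_on k U"
  shows "\<phi> \<in> Ck_on (Suc k) U"
  unfolding Ck_on_Suc
proof (intro conjI ballI)
  fix b :: 'a assume b: "b \<in> Basis"
  show "partially_differentiable_at b \<phi> x" if "x \<in> U" for x
    using partial_deriv_eqI(1)[OF D[OF b that]] .
  have "partial_deriv b \<phi> x = \<psi> b x" if "x \<in> U" for x
    using partial_deriv_eqI(2)[OF D[OF b that]] .
  then show "partial_deriv b \<phi> \<in> Ck_on k U"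
    using Ck_on_cong[OF U, of "partial_deriv b \<phi>" "\<psi> b"] assms(4)[OF b] by blast
qed fact

text \<open>To compute all iterated partial derivatives of a function, it suffices to guess a family \<open>\<Phi>\<close> indexed by lists of
  directions and to check one differentiation step. All explicit derivative formulas below are
  obtained in this way.\<close>

lemma Ck_onI_iter:
  fixes U :: "'a::euclidean_space set"
  assumes U: "open U"
    and 0: "\<And>x. x \<in> U \<Longrightarrow> \<Phi> [] x = \<phi> x"
    and D: "\<And>bs b x. set bs \<subseteq> Basis \<Longrightarrow> length bs < k \<Longrightarrow> b \<in> Basis \<Longrightarrow> x \<in> U \<Longrightarrow>
      ((\<lambda>t. \<Phi> bs (x + t *\<^sub>R b)) has_real_derivative \<Phi> (b # bs) x) (at 0)"
  shows "set bs \<subseteq> Basis \<Longrightarrow> length bs \<le> k \<Longrightarrow> x \<in> U \<Longrightarrow> iter_partial bs \<phi> x = \<Phi> bs x"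
    and "(\<And>bs. set bs \<subseteq> Basis \<Longrightarrow> length bs \<le> k \<Longrightarrow> continuous_on U (\<Phi> bs)) \<Longrightarrow> \<phi> \<in> Ck_on k U"
proof -
  show *: "iter_partial bs \<phi> x = \<Phi> bs x" if "set bs \<subseteq> Basis" "length bs \<le> k" "x \<in> U" for bs x
    using that
  proof (induction bs arbitrary: x)
    case (Cons b bs)
    have "iter_partial (b # bs) \<phi> x = partial_deriv b (\<Phi> bs) x"
      unfolding iter_partial_simps by (rule partial_deriv_cong(2)[OF U]) (use Cons in auto)
    also have "\<dots> = \<Phi> (b # bs) x" using Cons.prems by (intro partial_deriv_eqI(2) D) auto
    finally show ?case .
  qed (simp add: 0)
  show "\<phi> \<in> Ck_on k U"
    if c: "\<And>bs. set bs \<subseteq> Basis \<Longrightarrow> length bs \<le> k \<Longrightarrow> continuous_on U (\<Phi> bs)"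
    unfolding Ck_on_def
  proof (intro CollectI allI impI conjI ballI)
    fix bs :: "'a list"
    assume bs: "set bs \<subseteq> Basis \<and> length bs \<le> k"
    show "continuous_on U (iter_partial bs \<phi>)"
      using c[of bs] * bs by (simp cong: continuous_on_cong)
    fix b x :: 'a assume "length bs < k" "b \<in> Basis" "x \<in> U"
    then have "partially_differentiable_at b (\<Phi> bs) x"
      using bs by (intro partial_deriv_eqI(1)[OF D]) auto
    then show "partially_differentiable_at b (iter_partial bs \<phi>) x"
      using partial_deriv_cong(1)[OF U \<open>x \<in> U\<close>, of "iter_partial bs \<phi>" "\<Phi> bs"] * bs by blast
  qed
qed

lemma
  fixes U :: "'a::euclidean_space set"
  assumes "open U" "\<phi> \<in> Ck_on k U" "\<psi> \<in> Ck_on k U"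
  shows iter_partial_lincomb: "set bs \<subseteq> Basis \<Longrightarrow> length bs \<le> k \<Longrightarrow> x \<in> U \<Longrightarrow>
      iter_partial bs (\<lambda>x. c * \<phi> x + d * \<psi> x) x = c * iter_partial bs \<phi> x + d * iter_partial bs \<psi> x"
    and Ck_on_lincomb: "(\<lambda>x. c * \<phi> x + d * \<psi> x) \<in> Ck_on k U"
proof -
  note * = Ck_onI_iter[OF assms(1), of "\<lambda>bs x. c * iter_partial bs \<phi> x + d * iter_partial bs \<psi> x"
      "\<lambda>x. c * \<phi> x + d * \<psi> x" k]
  have D: "((\<lambda>t. c * iter_partial bs \<phi> (x + t *\<^sub>R b) + d * iter_partial bs \<psi> (x + t *\<^sub>R b))
      has_real_derivative c * iter_partial (b # bs) \<phi> x + d * iter_partial (b # bs) \<psi> x) (at 0)"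
    if "set bs \<subseteq> Basis" "length bs < k" "b \<in> Basis" "x \<in> U" for bs b x
    using that assms by (intro DERIV_add DERIV_cmult Ck_on_iter_has_partial) auto
  show "set bs \<subseteq> Basis \<Longrightarrow> length bs \<le> k \<Longrightarrow> x \<in> U \<Longrightarrow>
      iter_partial bs (\<lambda>x. c * \<phi> x + d * \<psi> x) x = c * iter_partial bs \<phi> x + d * iter_partial bs \<psi> x"
    by (rule *(1)) (use D in auto)
  show "(\<lambda>x. c * \<phi> x + d * \<psi> x) \<in> Ck_on k U"
    by (rule *(2)) (use D assms in \<open>auto intro!: continuous_intros Ck_on_iter_continuous\<close>)
qed

lemma Ck_on_mult:
  fixes U :: "'a::euclidean_space set"
  assumes "open U" "\<phi> \<in> Ck_on k U" "\<psi> \<in> Ck_on k U"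
  shows "(\<lambda>x. \<phi> x * \<psi> x) \<in> Ck_on k U"
  using assms(2,3)
proof (induction k arbitrary: \<phi> \<psi>)
  case 0
  then show ?case by (simp add: Ck_on_0 continuous_on_mult)
next
  case (Suc k)
  note c = Suc.prems[unfolded Ck_on_Suc]
  show ?case
  proof (rule Ck_on_SucI[OF assms(1), where \<psi> = "\<lambda>b x. 1 * (partial_deriv b \<phi> x * \<psi> x) + 1 * (\<phi> x * partial_deriv b \<psi> x)"])
    show "continuous_on U (\<lambda>x. \<phi> x * \<psi> x)" using c by (intro continuous_on_mult) auto
    show "((\<lambda>t. \<phi> (x + t *\<^sub>R b) * \<psi> (x + t *\<^sub>R b)) has_real_derivative
        1 * (partial_deriv b \<phi> x * \<psi> x) + 1 * (\<phi> x * partial_deriv b \<psi> x)) (at 0)"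
      if "b \<in> Basis" "x \<in> U" for b x
      using DERIV_mult[OF partially_differentiable_atD partially_differentiable_atD, of b \<phi> x b \<psi> x] c that
      by (simp add: mult.commute add.commute)
    show "(\<lambda>x. 1 * (partial_deriv b \<phi> x * \<psi> x) + 1 * (\<phi> x * partial_deriv b \<psi> x)) \<in> Ck_on k U"
      if "b \<in> Basis" for b
      using c that Suc.prems by (intro Ck_on_lincomb assms(1) Suc.IH) (auto intro: Ck_on_Suc_imp)
  qed
qed

text \<open>Powers of the positive part serve as building blocks for a cutoff function of class \<open>C\<^sup>k\<close>.\<close>

lemma DERIV_pos_part_power:
  fixes y :: real
  assumes "2 \<le> n"
  shows "((\<lambda>y. max 0 y ^ n) has_real_derivative real n * max 0 y ^ (n - 1)) (at y)"
proof -
  consider "y < 0" | "0 < y" | "y = 0" by linarith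
  then show ?thesis
  proof cases
    case 1
    then have "\<forall>\<^sub>F z in nhds y. z < 0" by (intro order_tendstoD(2)[OF filterlim_ident])
    then have "\<forall>\<^sub>F z in nhds y. max 0 z ^ n = 0" by eventually_elim (use assms in \<open>simp add: max_def\<close>)
    then have "((\<lambda>y. max 0 y ^ n) has_real_derivative 0) (at y) \<longleftrightarrow> ((\<lambda>y. 0::real) has_real_derivative 0) (at y)"
      by (intro DERIV_cong_ev) auto
    then show ?thesis using 1 assms by (simp add: max_def power_0_left)
  next
    case 2
    then have "\<forall>\<^sub>F z in nhds y. 0 < z" by (intro order_tendstoD(1)[OF filterlim_ident])
    then have "\<forall>\<^sub>F z in nhds y. max 0 z ^ n = z ^ n" by eventually_elim simp
    then have "((\<lambda>y. max 0 y ^ n) has_real_derivative real n * y ^ (n - 1)) (at y) \<longleftrightarrow>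
        ((\<lambda>y. y ^ n) has_real_derivative real n * y ^ (n - 1)) (at y)"
      by (intro DERIV_cong_ev) auto
    then show ?thesis using 2 DERIV_pow[of n y] by simp
  next
    case 3
    have "((\<lambda>h. max 0 h ^ n / h) \<longlongrightarrow> 0) (at (0::real))"
    proof (rule Lim_null_comparison)
      show "\<forall>\<^sub>F h in at 0. norm (max 0 h ^ n / h) \<le> \<bar>h :: real\<bar>"
        unfolding eventually_at
      proof (intro exI[of _ 1] conjI ballI impI)
        fix h :: real assume h: "h \<noteq> 0 \<and> dist h 0 < 1"
        have "max 0 h ^ n \<le> max 0 h ^ 2" using h assms by (intro power_decreasing) auto
        also have "\<dots> \<le> h\<^sup>2" by (simp add: max_def)
        finally show "norm (max 0 h ^ n / h) \<le> \<bar>h\<bar>"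
          using h by (simp add: divide_le_eq power2_eq_square abs_mult[symmetric])
      qed simp
      show "((\<lambda>h::real. \<bar>h\<bar>) \<longlongrightarrow> 0) (at 0)" by (intro tendsto_eq_intros) auto
    qed
    then show ?thesis using 3 assms by (simp add: has_field_derivative_iff power_0_left)
  qed
qed

lemma Ck_on_pos_part_power:
  fixes U :: "'a::euclidean_space set"
  assumes "open U" "g \<in> Ck_on k U" "Suc k \<le> n"
  shows "(\<lambda>x. max 0 (g x) ^ n) \<in> Ck_on k U"
  using assms(2,3)
proof (induction k arbitrary: n)
  case 0
  then show ?case by (auto simp: Ck_on_0 intro!: continuous_intros)
next
  case (Suc k)
  note c = Suc.prems(1)[unfolded Ck_on_Suc]
  show ?case
  proof (rule Ck_on_SucI[OF assms(1), where \<psi> = "\<lambda>b x. real n * (max 0 (g x) ^ (n - 1) * partial_deriv b g x) + 0 * g x"])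
    show "continuous_on U (\<lambda>x. max 0 (g x) ^ n)" using c by (intro continuous_intros) auto
    show "((\<lambda>t. max 0 (g (x + t *\<^sub>R b)) ^ n) has_real_derivative
        real n * (max 0 (g x) ^ (n - 1) * partial_deriv b g x) + 0 * g x) (at 0)"
      if "b \<in> Basis" "x \<in> U" for b x
    proof -
      have "partially_differentiable_at b g x" using c that by blast
      from partially_differentiable_atD[OF this] show ?thesis
        using DERIV_chain2[of "\<lambda>y. max 0 y ^ n" "real n * max 0 (g x) ^ (n - 1)" "\<lambda>t. g (x + t *\<^sub>R b)" 0]
          DERIV_pos_part_power[of n "g x"] Suc.prems(2) by (simp add: mult.assoc)
    qed
    show "(\<lambda>x. real n * (max 0 (g x) ^ (n - 1) * partial_deriv b g x) + 0 * g x) \<in> Ck_on k U"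
      if "b \<in> Basis" for b
      using c that Suc.prems by (intro Ck_on_lincomb Ck_on_mult assms(1) Suc.IH) (auto intro: Ck_on_Suc_imp)
  qed
qed

lemma
  fixes U :: "'a::euclidean_space set" and D :: "nat \<Rightarrow> real \<Rightarrow> real"
  assumes "open U" and D: "\<And>i y. y \<in> I \<Longrightarrow> (D i has_real_derivative D (Suc i) y) (at y)"
    and I: "\<And>x. x \<in> U \<Longrightarrow> a \<bullet> x \<in> I"
  shows iter_partial_ridge: "set bs \<subseteq> Basis \<Longrightarrow> x \<in> U \<Longrightarrow>
      iter_partial bs (\<lambda>x. D 0 (a \<bullet> x)) x = prod_list (map (\<lambda>b. a \<bullet> b) bs) * D (length bs) (a \<bullet> x)"
    and Ck_on_ridge: "(\<lambda>x. D 0 (a \<bullet> x)) \<in> Ck_on k U"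
proof -
  define \<Phi> where "\<Phi> bs x = prod_list (map (\<lambda>b. a \<bullet> b) bs) * D (length bs) (a \<bullet> x)" for bs x
  have DD: "((\<lambda>t. \<Phi> bs (x + t *\<^sub>R b)) has_real_derivative \<Phi> (b # bs) x) (at 0)" if "x \<in> U" for bs b x
  proof -
    have "((\<lambda>t. a \<bullet> (x + t *\<^sub>R b)) has_real_derivative a \<bullet> b) (at 0)"
      unfolding inner_add_right inner_scaleR_right by (auto intro!: derivative_eq_intros)
    from DERIV_chain2[OF _ this, of "D (length bs)" "D (Suc (length bs)) (a \<bullet> x)"]
    have "((\<lambda>t. D (length bs) (a \<bullet> (x + t *\<^sub>R b))) has_real_derivative D (Suc (length bs)) (a \<bullet> x) * (a \<bullet> b)) (at 0)"
      using D[OF I[OF that]] by simp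
    from DERIV_cmult[OF this, of "prod_list (map (\<lambda>b. a \<bullet> b) bs)"]
    show ?thesis by (simp add: \<Phi>_def mult_ac)
  qed
  note * = Ck_onI_iter[OF assms(1), of \<Phi> "\<lambda>x. D 0 (a \<bullet> x)"]
  show "iter_partial bs (\<lambda>x. D 0 (a \<bullet> x)) x = prod_list (map (\<lambda>b. a \<bullet> b) bs) * D (length bs) (a \<bullet> x)"
    if "set bs \<subseteq> Basis" "x \<in> U"
  proof -
    have "iter_partial bs (\<lambda>x. D 0 (a \<bullet> x)) x = \<Phi> bs x"
      by (rule *(1)[of "length bs"]) (use DD that in \<open>auto simp: \<Phi>_def\<close>)
    then show ?thesis by (simp add: \<Phi>_def)
  qed
  have "continuous_on I (D i)" for i
    using D by (meson DERIV_isCont continuous_at_imp_continuous_on)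
  then have "continuous_on U (\<Phi> bs)" for bs
    unfolding \<Phi>_def using I by (intro continuous_intros continuous_on_compose2[of I "D (length bs)" U]) auto
  then show "(\<lambda>x. D 0 (a \<bullet> x)) \<in> Ck_on k U"
    by (intro *(2)) (use DD in \<open>auto simp: \<Phi>_def\<close>)
qed

lemma
  fixes U :: "'a::euclidean_space set"
  assumes "open U" "\<phi> \<in> Ck_on k U" "l \<noteq> 0"
  defines "V \<equiv> (\<lambda>x. l *\<^sub>R x) -` U"
  shows iter_partial_dilation: "set bs \<subseteq> Basis \<Longrightarrow> length bs \<le> k \<Longrightarrow> x \<in> V \<Longrightarrow>
      iter_partial bs (\<lambda>x. \<phi> (l *\<^sub>R x)) x = l ^ length bs * iter_partial bs \<phi> (l *\<^sub>R x)"
    and Ck_on_dilation: "(\<lambda>x. \<phi> (l *\<^sub>R x)) \<in> Ck_on k V"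
proof -
  have V: "open V" unfolding V_def by (intro open_vimage assms(1) continuous_intros)
  note * = Ck_onI_iter[OF V, of "\<lambda>bs x. l ^ length bs * iter_partial bs \<phi> (l *\<^sub>R x)" "\<lambda>x. \<phi> (l *\<^sub>R x)" k]
  have D: "((\<lambda>t. l ^ length bs * iter_partial bs \<phi> (l *\<^sub>R (x + t *\<^sub>R b)))
      has_real_derivative l ^ length (b # bs) * iter_partial (b # bs) \<phi> (l *\<^sub>R x)) (at 0)"
    if bs: "set bs \<subseteq> Basis" "length bs < k" "b \<in> Basis" "x \<in> V" for bs b x
  proof -
    have "((\<lambda>t. iter_partial bs \<phi> (l *\<^sub>R x + t *\<^sub>R b)) has_real_derivative iter_partial (b # bs) \<phi> (l *\<^sub>R x)) (at (l * 0))"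
      using Ck_on_iter_has_partial[OF assms(2) bs(1-3), of "l *\<^sub>R x"] bs(4) by (simp add: V_def)
    moreover have "((\<lambda>t. l * t) has_real_derivative l) (at 0)" by (auto intro!: derivative_eq_intros)
    ultimately have "((\<lambda>t. iter_partial bs \<phi> (l *\<^sub>R x + (l * t) *\<^sub>R b)) has_real_derivative iter_partial (b # bs) \<phi> (l *\<^sub>R x) * l) (at 0)"
      by (rule DERIV_chain2[where f = "\<lambda>t. iter_partial bs \<phi> (l *\<^sub>R x + t *\<^sub>R b)"])
    from DERIV_cmult[OF this, of "l ^ length bs"] show ?thesis
      by (simp add: scaleR_add_right mult_ac)
  qed
  show "set bs \<subseteq> Basis \<Longrightarrow> length bs \<le> k \<Longrightarrow> x \<in> V \<Longrightarrow>
      iter_partial bs (\<lambda>x. \<phi> (l *\<^sub>R x)) x = l ^ length bs * iter_partial bs \<phi> (l *\<^sub>R x)"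
    by (rule *(1)) (use D in auto)
  have "continuous_on V (\<lambda>x. iter_partial bs \<phi> (l *\<^sub>R x))" if "set bs \<subseteq> Basis" "length bs \<le> k" for bs
    using Ck_on_iter_continuous[OF assms(2) that]
    by (rule continuous_on_compose2) (auto simp: V_def intro!: continuous_intros)
  then show "(\<lambda>x. \<phi> (l *\<^sub>R x)) \<in> Ck_on k V"
    by (intro *(2)) (use D in \<open>auto intro!: continuous_intros\<close>)
qed

text \<open>All derivatives fall on \<open>F\<close>, so the factor \<open>q\<close> enters only through its values.\<close>

lemma iter_partial_convolution:
  fixes F q :: "'a::euclidean_space \<Rightarrow> real"
  assumes F: "F \<in> Ck_on k UNIV" and q: "continuous_on (cbox a b) q"
    and "set bs \<subseteq> Basis" "length bs \<le> k"
  shows "iter_partial bs (\<lambda>x. integral (cbox a b) (\<lambda>z. F (x - z) * q z)) x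
    = integral (cbox a b) (\<lambda>z. iter_partial bs F (x - z) * q z)"
proof (rule Ck_onI_iter(1)[of UNIV "\<lambda>bs x. integral (cbox a b) (\<lambda>z. iter_partial bs F (x - z) * q z)" _ k])
  fix bs and c x :: 'a assume bs: "set bs \<subseteq> (Basis :: 'a set)" "length bs < k" "c \<in> Basis"
  have G: "((\<lambda>t. iter_partial bs F (y + t *\<^sub>R c)) has_real_derivative iter_partial (c # bs) F (y + t0 *\<^sub>R c)) (at t0)"
    for y t0
  proof -
    have "((\<lambda>t. iter_partial bs F ((y + t0 *\<^sub>R c) + t *\<^sub>R c)) has_real_derivative iter_partial (c # bs) F (y + t0 *\<^sub>R c)) (at 0)"
      by (rule Ck_on_iter_has_partial[OF F bs]) simp
    then show ?thesis
      using DERIV_shift[of "\<lambda>t. iter_partial bs F (y + t *\<^sub>R c)" _ 0 t0]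
      by (simp add: scaleR_add_left add_ac)
  qed
  have c0: "continuous_on UNIV (iter_partial bs F)" and c1: "continuous_on UNIV (iter_partial (c # bs) F)"
    using bs by (auto intro!: Ck_on_iter_continuous[OF F] simp del: iter_partial_simps)
  have "((\<lambda>t. integral (cbox a b) (\<lambda>z. iter_partial bs F ((x - z) + t *\<^sub>R c) * q z)) has_field_derivative
     integral (cbox a b) (\<lambda>z. iter_partial (c # bs) F ((x - z) + 0 *\<^sub>R c) * q z)) (at 0 within UNIV)"
  proof (rule leibniz_rule_field_derivative[where U = UNIV and fx = "\<lambda>t z. iter_partial (c # bs) F ((x - z) + t *\<^sub>R c) * q z"])
    show "((\<lambda>t. iter_partial bs F (x - z + t *\<^sub>R c) * q z) has_real_derivative
            iter_partial (c # bs) F (x - z + t *\<^sub>R c) * q z) (at t within UNIV)" for t z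
      using DERIV_cmult_right[OF G] by simp
    show "(\<lambda>z. iter_partial bs F (x - z + t *\<^sub>R c) * q z) integrable_on cbox a b" for t
      by (intro integrable_continuous continuous_on_mult q continuous_on_compose2[OF c0]) (auto intro!: continuous_intros)
    have "continuous_on (UNIV \<times> cbox a b) (\<lambda>y. q (snd y))"
      by (rule continuous_on_compose2[OF q]) (auto intro!: continuous_intros)
    then show "continuous_on (UNIV \<times> cbox a b) (\<lambda>(t, z). iter_partial (c # bs) F (x - z + t *\<^sub>R c) * q z)"
      unfolding case_prod_beta
      by (intro continuous_on_mult continuous_on_compose2[OF c1]) (auto intro!: continuous_intros)
  qed auto
  then show "((\<lambda>t. integral (cbox a b) (\<lambda>z. iter_partial bs F (x + t *\<^sub>R c - z) * q z)) has_real_derivative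
     integral (cbox a b) (\<lambda>z. iter_partial (c # bs) F (x - z) * q z)) (at 0)"
    by (simp add: add_diff_eq diff_add_eq del: iter_partial_simps)
qed (use assms in auto)

section \<open>Limits in the norm of the unit ball\<close>

lemma finite_multi_indices: "finite (multi_indices k :: 'a::euclidean_space multiset set)"
proof (rule finite_subset)
  show "multi_indices k \<subseteq> mset ` {xs. set xs \<subseteq> (Basis :: 'a set) \<and> length xs \<le> k}"
  proof
    fix \<alpha> :: "'a multiset" assume \<alpha>: "\<alpha> \<in> multi_indices k"
    obtain xs where "mset xs = \<alpha>" using ex_mset by blast
    then show "\<alpha> \<in> mset ` {xs. set xs \<subseteq> (Basis :: 'a set) \<and> length xs \<le> k}"
      using \<alpha> by (force simp: multi_indices_def)
  qed
  show "finite (mset ` {xs. set xs \<subseteq> (Basis :: 'a set) \<and> length xs \<le> k})"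
    by (intro finite_imageI finite_lists_length_le) simp
qed

lemma multi_deriv_list:
  assumes "\<alpha> \<in> multi_indices k"
  obtains bs where "set bs \<subseteq> Basis" "length bs \<le> k" "multi_deriv \<alpha> = iter_partial bs"
proof -
  define bs where "bs = (SOME bs. mset bs = \<alpha>)"
  have "mset bs = \<alpha>" unfolding bs_def by (rule someI_ex[OF ex_mset])
  then have "set bs \<subseteq> Basis" "length bs \<le> k"
    using assms by (auto simp: multi_indices_def)
  then show ?thesis by (rule that) (simp add: multi_deriv_def bs_def fun_eq_iff)
qed

text \<open>Closeness is measured with the same chosen orders of differentiation as \<^const>\<open>multi_deriv\<close>: membership in
  \<^const>\<open>Ck_closure\<close> gives uniform continuity of exactly these derivatives.\<close>

definition Ck_close :: "nat \<Rightarrow> real \<Rightarrow> ('a::euclidean_space \<Rightarrow> real) \<Rightarrow> ('a \<Rightarrow> real) \<Rightarrow> bool" where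
  "Ck_close k e f g \<longleftrightarrow>
     (\<forall>\<alpha>\<in>multi_indices k. \<forall>x\<in>ball 0 1. \<bar>multi_deriv \<alpha> f x - multi_deriv \<alpha> g x\<bar> \<le> e)"

lemma Ck_closeI:
  assumes "\<And>bs x. set bs \<subseteq> Basis \<Longrightarrow> length bs \<le> k \<Longrightarrow> x \<in> ball 0 1 \<Longrightarrow>
    \<bar>iter_partial bs f x - iter_partial bs g x\<bar> \<le> e"
  shows "Ck_close k e f g"
  unfolding Ck_close_def using assms by (metis multi_deriv_list)

lemma Ck_close_trans: "Ck_close k d f g \<Longrightarrow> Ck_close k e g h \<Longrightarrow> Ck_close k (d + e) f h"
  unfolding Ck_close_def by (smt (verit, best))

lemma multi_deriv_lincomb:
  fixes \<phi> \<psi> :: "'a::euclidean_space \<Rightarrow> real"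
  assumes "\<alpha> \<in> multi_indices k" "open U" "\<phi> \<in> Ck_on k U" "\<psi> \<in> Ck_on k U" "x \<in> U"
  shows "multi_deriv \<alpha> (\<lambda>x. c * \<phi> x + d * \<psi> x) x = c * multi_deriv \<alpha> \<phi> x + d * multi_deriv \<alpha> \<psi> x"
proof -
  obtain bs where bs: "set bs \<subseteq> Basis" "length bs \<le> k" "multi_deriv \<alpha> = iter_partial bs"
    using multi_deriv_list[OF assms(1)] .
  show ?thesis unfolding bs(3) by (rule iter_partial_lincomb[OF assms(2-4) bs(1,2) assms(5)])
qed

lemma multi_deriv_cong:
  fixes x :: "'a::euclidean_space"
  assumes "open U" "x \<in> U" "\<And>y. y \<in> U \<Longrightarrow> \<phi> y = \<psi> y"
  shows "multi_deriv \<alpha> \<phi> x = multi_deriv \<alpha> \<psi> x"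
  unfolding multi_deriv_def by (rule iter_partial_cong[OF assms])

definition Ck_limits :: "nat \<Rightarrow> ('a::euclidean_space \<Rightarrow> real) set \<Rightarrow> ('a \<Rightarrow> real) set" where
  "Ck_limits k S = {g \<in> Ck_on k (ball 0 1). \<forall>e>0. \<exists>u\<in>S \<inter> Ck_on k (ball 0 1). Ck_close k e g u}"

lemma Ck_limits_closed:
  assumes "g \<in> Ck_on k (ball 0 1)" "\<And>e. e > 0 \<Longrightarrow> \<exists>h\<in>Ck_limits k S. Ck_close k e g h"
  shows "g \<in> Ck_limits k S"
  unfolding Ck_limits_def
proof (intro CollectI conjI allI impI)
  fix e :: real assume e: "e > 0"
  obtain h where h: "h \<in> Ck_limits k S" "Ck_close k (e/2) g h" using assms(2)[of "e/2"] e by auto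
  obtain u where u: "u \<in> S \<inter> Ck_on k (ball 0 1)" "Ck_close k (e/2) h u"
    using h(1) e unfolding Ck_limits_def by (auto dest!: spec[of _ "e/2"])
  then show "\<exists>u\<in>S \<inter> Ck_on k (ball 0 1). Ck_close k e g u" using Ck_close_trans[OF h(2) u(2)] by auto
qed fact

lemma Ck_limits_base: "u \<in> S \<Longrightarrow> u \<in> Ck_on k (ball 0 1) \<Longrightarrow> u \<in> Ck_limits k S"
  unfolding Ck_limits_def Ck_close_def by (auto intro!: bexI[of _ u])

lemma Ck_limits_cong:
  assumes "\<And>x. x \<in> ball 0 1 \<Longrightarrow> f x = g x" "f \<in> Ck_limits k S"
  shows "g \<in> Ck_limits k S"
proof -
  have "multi_deriv \<alpha> f x = multi_deriv \<alpha> g x" if "x \<in> ball 0 1" for \<alpha> x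
    using assms(1) that by (intro multi_deriv_cong[of "ball 0 1"]) auto
  then show ?thesis
    using assms(2) Ck_on_cong[of "ball 0 1" f g k, OF open_ball assms(1)] unfolding Ck_limits_def Ck_close_def by auto
qed

text \<open>Limits of a linear subspace form a linear subspace that is closed under limits. The density proof
  can therefore proceed by adding one family of functions after the other to the known limits.\<close>

locale fun_subspace =
  fixes S :: "('a::euclidean_space \<Rightarrow> real) set"
  assumes lincomb: "u \<in> S \<Longrightarrow> v \<in> S \<Longrightarrow> (\<lambda>x. c * u x + d * v x) \<in> S"
    and nonempty: "S \<noteq> {}"
begin

lemma zero_mem: "(\<lambda>x. 0) \<in> S"
  using nonempty lincomb[of _ _ 0 0] by auto

lemma Ck_limits_lincomb:
  assumes f: "f \<in> Ck_limits k S" and g: "g \<in> Ck_limits k S"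
  shows "(\<lambda>x. c * f x + d * g x) \<in> Ck_limits k S"
  unfolding Ck_limits_def
proof (intro CollectI conjI allI impI)
  have fg: "f \<in> Ck_on k (ball 0 1)" "g \<in> Ck_on k (ball 0 1)" using f g by (auto simp: Ck_limits_def)
  then show "(\<lambda>x. c * f x + d * g x) \<in> Ck_on k (ball 0 1)" by (intro Ck_on_lincomb) auto
  fix e :: real assume e: "e > 0"
  define e' where "e' = e / (\<bar>c\<bar> + \<bar>d\<bar> + 1)"
  have e': "e' > 0" "(\<bar>c\<bar> + \<bar>d\<bar>) * e' \<le> e" using e by (auto simp: e'_def field_simps)
  obtain u v where u: "u \<in> S" "u \<in> Ck_on k (ball 0 1)" "Ck_close k e' f u"
    and v: "v \<in> S" "v \<in> Ck_on k (ball 0 1)" "Ck_close k e' g v"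
    using f g e'(1) unfolding Ck_limits_def by blast
  have "Ck_close k e (\<lambda>x. c * f x + d * g x) (\<lambda>x. c * u x + d * v x)"
    unfolding Ck_close_def
  proof (intro ballI)
    fix \<alpha> :: "'a multiset" and x :: 'a
    assume \<alpha>: "\<alpha> \<in> multi_indices k" and x: "x \<in> ball 0 1"
    let ?D = "\<lambda>h. multi_deriv \<alpha> h x"
    have "?D (\<lambda>x. c * f x + d * g x) - ?D (\<lambda>x. c * u x + d * v x) = c * (?D f - ?D u) + d * (?D g - ?D v)"
      using \<alpha> x fg u v by (simp add: multi_deriv_lincomb[of \<alpha> k "ball 0 1"] algebra_simps)
    also have "\<bar>\<dots>\<bar> \<le> \<bar>c\<bar> * \<bar>?D f - ?D u\<bar> + \<bar>d\<bar> * \<bar>?D g - ?D v\<bar>"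
      using abs_triangle_ineq[of "c * (?D f - ?D u)" "d * (?D g - ?D v)"] by (simp add: abs_mult)
    also have "\<dots> \<le> \<bar>c\<bar> * e' + \<bar>d\<bar> * e'"
      using u(3) v(3) \<alpha> x unfolding Ck_close_def by (intro add_mono mult_left_mono) auto
    finally show "\<bar>?D (\<lambda>x. c * f x + d * g x) - ?D (\<lambda>x. c * u x + d * v x)\<bar> \<le> e"
      using e'(2) by (simp add: algebra_simps)
  qed
  then show "\<exists>w\<in>S \<inter> Ck_on k (ball 0 1). Ck_close k e (\<lambda>x. c * f x + d * g x) w"
    using lincomb[OF u(1) v(1), of c d] Ck_on_lincomb[OF open_ball u(2) v(2), of c d] by blast
qed

lemma Ck_limits_scale: "f \<in> Ck_limits k S \<Longrightarrow> (\<lambda>x. c * f x) \<in> Ck_limits k S"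
  using Ck_limits_lincomb[of f k f c 0] by simp

lemma Ck_limits_zero: "(\<lambda>x. 0) \<in> Ck_limits k S"
proof (rule Ck_limits_base[OF zero_mem])
  show "(\<lambda>x. 0) \<in> Ck_on k (ball (0::'a) 1)"
    using Ck_on_ridge[of "ball 0 1" UNIV "\<lambda>_ _. 0" "0::'a" k] by simp
qed

lemma Ck_limits_sum:
  "finite J \<Longrightarrow> (\<And>j. j \<in> J \<Longrightarrow> f j \<in> Ck_limits k S) \<Longrightarrow> (\<lambda>x. \<Sum>j\<in>J. f j x) \<in> Ck_limits k S"
proof (induction J rule: finite_induct)
  case (insert j J)
  then show ?case using Ck_limits_lincomb[of "f j" k "\<lambda>x. \<Sum>j\<in>J. f j x" 1 1] by simp
qed (simp add: Ck_limits_zero)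

end

section \<open>Powers and exponentials of linear forms\<close>

text \<open>\<open>taylor_rem D n i\<close> is the \<open>i\<close>-th derivative of the \<open>n\<close>-th Taylor remainder at \<open>0\<close> of \<open>D 0\<close>, for a
  function with successive derivatives \<open>D i\<close>. For \<open>i \<ge> n\<close> the sum is empty by truncated subtraction, in
  agreement with differentiating a polynomial of degree below \<open>n\<close>.\<close>

definition taylor_rem :: "(nat \<Rightarrow> real \<Rightarrow> real) \<Rightarrow> nat \<Rightarrow> nat \<Rightarrow> real \<Rightarrow> real" where
  "taylor_rem D n i w = D i w - (\<Sum>m<n-i. D (i + m) 0 / fact m * w ^ m)"

lemma DERIV_taylor_rem:
  assumes "(D i has_real_derivative D (Suc i) w) (at w)"
  shows "(taylor_rem D n i has_real_derivative taylor_rem D n (Suc i) w) (at w)"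
proof -
  have "((\<lambda>w. \<Sum>m<N. D (i + m) 0 / fact m * w ^ m) has_real_derivative
      (\<Sum>m<N-1. D (Suc i + m) 0 / fact m * w ^ m)) (at w)" for N
  proof (cases N)
    case (Suc N')
    have "((\<lambda>w. \<Sum>m<N. D (i + m) 0 / fact m * w ^ m) has_real_derivative
        (\<Sum>m<N. D (i + m) 0 / fact m * (real m * w ^ (m - 1)))) (at w)"
      by (intro DERIV_sum DERIV_cmult) (use DERIV_pow in auto)
    also have "(\<Sum>m<N. D (i + m) 0 / fact m * (real m * w ^ (m - 1))) = (\<Sum>m<N-1. D (Suc i + m) 0 / fact m * w ^ m)"
    proof -
      have "D (i + Suc m) 0 / fact (Suc m) * (real (Suc m) * w ^ m) = D (Suc i + m) 0 / fact m * w ^ m" for m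
      proof -
        have "(fact (Suc m) :: real) = real (Suc m) * fact m" by simp
        then show ?thesis by (simp del: fact_Suc of_nat_Suc)
      qed
      then show ?thesis unfolding Suc sum.lessThan_Suc_shift by simp
    qed
    finally show ?thesis .
  qed simp
  from DERIV_diff[OF assms this[of "n - i"]] show ?thesis
    by (simp add: taylor_rem_def[abs_def])
qed

lemma taylor_rem_bound:
  assumes D: "\<And>i v. \<bar>v\<bar> \<le> \<rho> \<Longrightarrow> (D i has_real_derivative D (Suc i) v) (at v)"
    and B: "\<And>v. \<bar>v\<bar> \<le> \<rho> \<Longrightarrow> \<bar>D (max i n) v\<bar> \<le> B" and w: "\<bar>w\<bar> \<le> \<rho>"
  shows "\<bar>taylor_rem D n i w\<bar> \<le> B / fact (n - i) * \<bar>w\<bar> ^ (n - i)"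
proof -
  have "\<exists>t. \<bar>t\<bar> \<le> \<bar>w\<bar> \<and> D i w = (\<Sum>m<n-i. D (i + m) 0 / fact m * w ^ m) + D (i + (n - i)) t / fact (n - i) * w ^ (n - i)"
    by (rule Maclaurin_bi_le[where diff = "\<lambda>m. D (i + m)"]) (use D w in auto)
  then obtain t where t: "\<bar>t\<bar> \<le> \<bar>w\<bar>" "taylor_rem D n i w = D (max i n) t / fact (n - i) * w ^ (n - i)"
    by (auto simp: taylor_rem_def max_def split: if_splits)
  then show ?thesis
    using B[of t] w by (auto simp: abs_mult power_abs intro!: mult_right_mono divide_right_mono)
qed

lemma abs_inner_le_norm_on_ball:
  fixes a x :: "'a::euclidean_space"
  assumes "x \<in> ball 0 1"
  shows "\<bar>a \<bullet> x\<bar> \<le> norm a"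
proof -
  have "norm a * norm x \<le> norm a * 1" using assms by (intro mult_left_mono) auto
  then show ?thesis using Cauchy_Schwarz_ineq2[of a x] by simp
qed

text \<open>If \<open>f - g\<close> is a function of \<open>a \<bullet> x\<close> alone, each partial derivative only produces a factor \<open>a \<bullet> b\<close>, bounded by
  \<open>norm a\<close>; so closeness in \<open>C\<^sup>k\<close> follows from bounds in one variable.\<close>

lemma Ck_close_ridge:
  fixes a :: "'a::euclidean_space" and E :: "nat \<Rightarrow> real \<Rightarrow> real"
  assumes f: "f \<in> Ck_on k (ball 0 1)" and g: "g \<in> Ck_on k (ball 0 1)"
    and eq: "\<And>x. x \<in> ball 0 1 \<Longrightarrow> f x - g x = E 0 (a \<bullet> x)"
    and E: "\<And>i y. \<bar>y\<bar> \<le> norm a \<Longrightarrow> (E i has_real_derivative E (Suc i) y) (at y)"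
    and e: "\<And>i y. i \<le> k \<Longrightarrow> \<bar>y\<bar> \<le> norm a \<Longrightarrow> \<bar>E i y\<bar> * (1 + norm a) ^ k \<le> e"
  shows "Ck_close k e f g"
proof (rule Ck_closeI)
  fix bs :: "'a list" and x :: 'a
  assume bs: "set bs \<subseteq> Basis" "length bs \<le> k" and x: "x \<in> ball 0 1"
  have "iter_partial bs f x - iter_partial bs g x = iter_partial bs (\<lambda>x. 1 * f x + (- 1) * g x) x"
    using iter_partial_lincomb[OF open_ball f g bs x, of 1 "-1"] by simp
  also have "\<dots> = iter_partial bs (\<lambda>x. E 0 (a \<bullet> x)) x"
    using eq x by (intro iter_partial_cong[of "ball 0 1"]) auto
  also have "\<dots> = prod_list (map (\<lambda>b. a \<bullet> b) bs) * E (length bs) (a \<bullet> x)"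
    by (rule iter_partial_ridge[of "ball 0 1" "{y. \<bar>y\<bar> \<le> norm a}"]) (use bs x E abs_inner_le_norm_on_ball in auto)
  finally have *: "\<bar>iter_partial bs f x - iter_partial bs g x\<bar>
      = \<bar>prod_list (map (\<lambda>b. a \<bullet> b) bs)\<bar> * \<bar>E (length bs) (a \<bullet> x)\<bar>" by (simp add: abs_mult)
  have "\<bar>prod_list (map (\<lambda>b. a \<bullet> b) bs)\<bar> \<le> (1 + norm a) ^ length bs"
    using bs(1)
  proof (induction bs)
    case (Cons b bs)
    have "\<bar>a \<bullet> b\<bar> \<le> 1 + norm a"
      using Cons.prems Basis_le_norm[of b a] by auto
    then show ?case using Cons by (auto simp: abs_mult intro!: mult_mono)
  qed simp
  also have "\<dots> \<le> (1 + norm a) ^ k" using bs by (intro power_increasing) auto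
  finally show "\<bar>iter_partial bs f x - iter_partial bs g x\<bar> \<le> e"
    using e[OF bs(2) abs_inner_le_norm_on_ball[OF x, of a]] unfolding *
    by (smt (verit) mult.commute mult_right_mono abs_ge_zero)
qed

lemma Ck_on_exp_ridge: "(\<lambda>x. exp (a \<bullet> x)) \<in> Ck_on k (ball (0::'a::euclidean_space) 1)"
  using Ck_on_ridge[of "ball 0 1" UNIV "\<lambda>_. exp" a k] by simp

lemma Ck_on_power_ridge: "(\<lambda>x. (a \<bullet> x) ^ n) \<in> Ck_on k (ball (0::'a::euclidean_space) 1)"
proof (induction n)
  case 0
  then show ?case using Ck_on_ridge[of "ball 0 1" UNIV "\<lambda>i _. if i = 0 then 1 else 0" a k] by simp
next
  case (Suc n)
  have "(\<lambda>x. a \<bullet> x) \<in> Ck_on k (ball 0 1)"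
    using Ck_on_ridge[of "ball 0 1" UNIV "\<lambda>i y. if i = 0 then y else if i = 1 then 1 else 0" a k]
    by (auto intro!: derivative_eq_intros)
  from Ck_on_mult[OF open_ball this Suc] show ?case by simp
qed

text \<open>The successive derivatives of \<open>(1 + w) powr s\<close>.\<close>

definition powr_derivs :: "real \<Rightarrow> nat \<Rightarrow> real \<Rightarrow> real" where
  "powr_derivs s i w = (\<Prod>l<i. s - real l) * (1 + w) powr (s - real i)"

lemma DERIV_powr_derivs:
  assumes "-1 < w"
  shows "(powr_derivs s i has_real_derivative powr_derivs s (Suc i) w) (at w)"
proof -
  have "((\<lambda>w. (1 + w) powr (s - real i)) has_real_derivative (s - real i) * (1 + w) powr (s - real i - 1)) (at w)"
    using assms by (auto intro!: derivative_eq_intros)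
  from DERIV_cmult[OF this, of "\<Prod>l<i. s - real l"] show ?thesis
    unfolding powr_derivs_def[abs_def] by (simp add: mult_ac diff_diff_eq add.commute)
qed

lemma powr_derivs_bounded:
  obtains B where "0 \<le> B" "\<And>i w. i \<le> J \<Longrightarrow> \<bar>w\<bar> \<le> 1/2 \<Longrightarrow> \<bar>powr_derivs s i w\<bar> \<le> B"
proof -
  have "\<exists>C. \<forall>w\<in>{-1/2..1/2}. \<bar>powr_derivs s i w\<bar> \<le> C" for i
  proof -
    have "continuous_on {-1/2..1/2} (powr_derivs s i)"
      by (intro continuous_at_imp_continuous_on ballI DERIV_isCont[OF DERIV_powr_derivs]) auto
    then have "compact (powr_derivs s i ` {-1/2..1/2})" by (intro compact_continuous_image) auto
    then show ?thesis using compact_imp_bounded bounded_iff by (metis imageI real_norm_def)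
  qed
  then obtain C where C: "\<And>i w. w \<in> {-1/2..1/2} \<Longrightarrow> \<bar>powr_derivs s i w\<bar> \<le> C i" by metis
  show ?thesis
  proof (rule that[of "\<Sum>i\<le>J. \<bar>C i\<bar>"])
    fix i w assume "i \<le> J" "\<bar>w\<bar> \<le> (1/2::real)"
    then have "w \<in> {-1/2..1/2}" by auto
    from C[OF this, of i] have "\<bar>powr_derivs s i w\<bar> \<le> \<bar>C i\<bar>" by linarith
    also have "\<dots> \<le> (\<Sum>i\<le>J. \<bar>C i\<bar>)" using \<open>i \<le> J\<close> by (intro member_le_sum) auto
    finally show "\<bar>powr_derivs s i w\<bar> \<le> (\<Sum>i\<le>J. \<bar>C i\<bar>)" .
  qed (simp add: sum_nonneg)
qed

locale plane_wave_span = fun_subspace S for S :: "('a::euclidean_space \<Rightarrow> real) set" +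
  fixes s :: real and k :: nat
  assumes s01: "0 < s" "s < 1"
    and waves: "norm a < 1 \<Longrightarrow> (\<lambda>x. max 0 (1 + a \<bullet> x) powr s) \<in> S"
begin

lemma wave_mem_Ck_limits:
  assumes "norm a < 1"
  shows "(\<lambda>x. powr_derivs s 0 (a \<bullet> x)) \<in> Ck_limits k S"
proof (rule Ck_limits_cong)
  have gt: "-1 < a \<bullet> x" if "x \<in> ball 0 1" for x using abs_inner_le_norm_on_ball[OF that, of a] assms by auto
  show eq: "max 0 (1 + a \<bullet> x) powr s = powr_derivs s 0 (a \<bullet> x)" if "x \<in> ball 0 1" for x
    using gt[OF that] by (simp add: powr_derivs_def)
  have "(\<lambda>x. powr_derivs s 0 (a \<bullet> x)) \<in> Ck_on k (ball 0 1)"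
    by (rule Ck_on_ridge[of "ball 0 1" "{-1<..}"]) (use gt DERIV_powr_derivs in auto)
  then have "(\<lambda>x. max 0 (1 + a \<bullet> x) powr s) \<in> Ck_on k (ball 0 1)"
    using Ck_on_cong[of "ball 0 1" "\<lambda>x. max 0 (1 + a \<bullet> x) powr s" "\<lambda>x. powr_derivs s 0 (a \<bullet> x)", OF open_ball eq] by blast
  then show "(\<lambda>x. max 0 (1 + a \<bullet> x) powr s) \<in> Ck_limits k S"
    by (intro Ck_limits_base waves assms)
qed

text \<open>The function \<open>h\<close> in the proof is the plane wave in direction \<open>t a\<close> minus its Taylor terms below order \<open>n\<close>, divided by the
  coefficient of \<open>(a \<bullet> x) ^ n\<close>; by the induction hypothesis it is a limit. What remains is a Taylor remainder of order
  \<open>n + 1\<close> divided by \<open>t ^ n\<close>. Its \<open>i\<close>-th derivative carries \<open>t ^ i\<close> from the chain rule and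
  \<open>t ^ (n + 1 - i)\<close> from Taylor's theorem, in total at most \<open>t ^ (n + 1)\<close>, also when \<open>i > n + 1\<close> as \<open>t \<le> 1\<close>. So it is of order \<open>t\<close>.\<close>

lemma power_mem_Ck_limits: "(\<lambda>x. (a \<bullet> x) ^ n) \<in> Ck_limits k S"
proof (induction n rule: less_induct)
  case (less n)
  define D where "D = powr_derivs s"
  define R where "R = 1 + norm a"
  have R: "1 \<le> R" "norm a \<le> R" by (auto simp: R_def)
  have D0: "D n 0 \<noteq> 0"
  proof -
    have "s \<noteq> real l" for l using s01 by (cases l) auto
    then show ?thesis by (simp add: D_def powr_derivs_def)
  qed
  obtain B where B: "0 \<le> B" "\<And>i w. i \<le> n + k + 1 \<Longrightarrow> \<bar>w\<bar> \<le> 1/2 \<Longrightarrow> \<bar>D i w\<bar> \<le> B"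
    using powr_derivs_bounded[of "n + k + 1" s] unfolding D_def by blast
  show ?case
  proof (rule Ck_limits_closed)
    fix e :: real assume e: "e > 0"
    define C where "C = fact n / \<bar>D n 0\<bar> * B * R ^ (n + 1) * R ^ k"
    have C: "0 \<le> C" using B R by (simp add: C_def)
    define t where "t = min (1 / (2 * R)) (e / (C + 1))"
    have t: "0 < t" "t * R \<le> 1/2" "C * t \<le> e"
    proof -
      show "0 < t" using e C R by (simp add: t_def)
      have "t * R \<le> 1 / (2 * R) * R" using R by (intro mult_right_mono) (auto simp: t_def)
      then show "t * R \<le> 1/2" using R by simp
      have "C * t \<le> C * (e / (C + 1))" using C by (intro mult_left_mono) (auto simp: t_def)
      also have "\<dots> \<le> e" using C e by (simp add: field_simps)
      finally show "C * t \<le> e" .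
    qed
    have "t * 1 \<le> t * R" using t R by (intro mult_left_mono) auto
    then have t1: "t \<le> 1" using t(2) by linarith
    \<comment> \<open>the inverse of the \<open>n\<close>-th Taylor coefficient of the plane wave in the variable \<open>a \<bullet> x\<close>\<close>
    define c where "c = fact n / (D n 0 * t ^ n)"
    define h where "h x = c * D 0 ((t *\<^sub>R a) \<bullet> x) + (-1) * (\<Sum>m<n. (c * (D m 0 / fact m * t ^ m)) * (a \<bullet> x) ^ m)" for x
    have "norm (t *\<^sub>R a) < 1"
    proof -
      have "t * norm a \<le> t * R" using t R by (intro mult_left_mono) auto
      then have "t * norm a < 1" using t(2) by linarith
      then show ?thesis using t(1) by simp
    qed
    then have h: "h \<in> Ck_limits k S"
      unfolding h_def[abs_def] D_def
      by (intro Ck_limits_lincomb Ck_limits_sum wave_mem_Ck_limits Ck_limits_scale less.IH) auto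
    define E where "E i y = - c * t ^ i * taylor_rem D (n + 1) i (t * y)" for i y
    have ty: "\<bar>t * y\<bar> \<le> 1/2" if "\<bar>y\<bar> \<le> norm a" for y
    proof -
      have "t * \<bar>y\<bar> \<le> t * R" using that t R by (intro mult_left_mono) auto
      then have "t * \<bar>y\<bar> \<le> 1/2" using t(2) by linarith
      then show ?thesis using t(1) by (simp add: abs_mult)
    qed
    have DD: "(D i has_real_derivative D (Suc i) v) (at v)" if "\<bar>v\<bar> \<le> 1/2" for i v
      unfolding D_def using that by (intro DERIV_powr_derivs) auto
    have "Ck_close k e (\<lambda>x. (a \<bullet> x) ^ n) h"
    proof (rule Ck_close_ridge[where a = a and E = E])
      show "(\<lambda>x. (a \<bullet> x) ^ n) \<in> Ck_on k (ball 0 1)" by (rule Ck_on_power_ridge)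
      show "h \<in> Ck_on k (ball 0 1)" using h by (simp add: Ck_limits_def)
      fix x :: 'a assume "x \<in> ball 0 1"
      have "c * (D n 0 / fact n * (t * (a \<bullet> x)) ^ n) = (a \<bullet> x) ^ n"
        using D0 t by (simp add: c_def power_mult_distrib)
      then show "(a \<bullet> x) ^ n - h x = E 0 (a \<bullet> x)"
        by (simp add: h_def E_def taylor_rem_def algebra_simps sum_distrib_left power_mult_distrib)
    next
      fix i y assume y: "\<bar>y\<bar> \<le> norm a"
      have "((\<lambda>y. t * y) has_real_derivative t) (at y)" by (auto intro!: derivative_eq_intros)
      from DERIV_chain2[OF DERIV_taylor_rem[of D i "t * y" "n + 1", OF DD[OF ty[OF y]]] this]
      have "((\<lambda>y. taylor_rem D (n + 1) i (t * y)) has_real_derivative taylor_rem D (n + 1) (Suc i) (t * y) * t) (at y)" .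
      from DERIV_cmult[OF this, of "- c * t ^ i"]
      show "(E i has_real_derivative E (Suc i) y) (at y)" by (simp add: E_def[abs_def] mult_ac)
    next
      fix i y assume i: "i \<le> k" and y: "\<bar>y\<bar> \<le> norm a"
      have "\<bar>taylor_rem D (n + 1) i (t * y)\<bar> \<le> B / fact (n + 1 - i) * \<bar>t * y\<bar> ^ (n + 1 - i)"
        by (rule taylor_rem_bound[where \<rho> = "1/2"]) (use DD B i ty[OF y] in auto)
      also have "\<dots> \<le> B * \<bar>t * y\<bar> ^ (n + 1 - i)"
        using B(1) by (intro mult_right_mono) (auto simp: divide_le_eq mult_le_cancel_left1)
      also have "\<bar>t * y\<bar> ^ (n + 1 - i) \<le> (t * R) ^ (n + 1 - i)"
        using y t R by (intro power_mono) (auto simp: abs_mult intro!: mult_left_mono)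
      finally have "\<bar>taylor_rem D (n + 1) i (t * y)\<bar> \<le> B * (t * R) ^ (n + 1 - i)"
        using B(1) by (simp add: mult_left_mono)
      then have "\<bar>E i y\<bar> \<le> \<bar>c\<bar> * t ^ i * (B * (t * R) ^ (n + 1 - i))"
        using t unfolding E_def by (simp add: abs_mult mult_left_mono)
      also have "\<dots> = \<bar>c\<bar> * B * (t ^ (i + (n + 1 - i)) * R ^ (n + 1 - i))"
        by (simp add: power_mult_distrib power_add)
      also have "\<dots> \<le> \<bar>c\<bar> * B * (t ^ (n + 1) * R ^ (n + 1))"
        using t t1 R B(1) by (intro mult_left_mono mult_mono power_decreasing power_increasing) auto
      also have "\<dots> = fact n / \<bar>D n 0\<bar> * B * R ^ (n + 1) * t"
        using t by (simp add: c_def abs_mult)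
      finally have "\<bar>E i y\<bar> * R ^ k \<le> fact n / \<bar>D n 0\<bar> * B * R ^ (n + 1) * t * R ^ k"
        using R by (intro mult_right_mono) auto
      also have "\<dots> = C * t" by (simp add: C_def)
      finally show "\<bar>E i y\<bar> * (1 + norm a) ^ k \<le> e" using t by (simp add: R_def)
    qed
    then show "\<exists>h\<in>Ck_limits k S. Ck_close k e (\<lambda>x. (a \<bullet> x) ^ n) h" using h by blast
  qed (rule Ck_on_power_ridge)
qed

lemma exp_mem_Ck_limits: "(\<lambda>x. exp (a \<bullet> x)) \<in> Ck_limits k S"
proof (rule Ck_limits_closed)
  fix e :: real assume e: "e > 0"
  define R where "R = 1 + norm a"
  have R: "1 \<le> R" "norm a \<le> R" by (auto simp: R_def)
  have "(\<lambda>n. R ^ n / fact n) \<longlonglongrightarrow> 0" 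
    using summable_LIMSEQ_zero[OF summable_exp[of R]] by (simp add: divide_inverse mult.commute)
  then have "(\<lambda>n. exp R * (R ^ n / fact n) * R ^ k) \<longlonglongrightarrow> exp R * 0 * R ^ k" by (intro tendsto_intros)
  then have "\<forall>\<^sub>F n in sequentially. exp R * (R ^ n / fact n) * R ^ k < e" using order_tendstoD(2)[of _ "exp R * 0 * R ^ k"] e by simp
  then obtain N where N: "\<And>n. n \<ge> N \<Longrightarrow> exp R * (R ^ n / fact n) * R ^ k < e"
    by (auto simp: eventually_sequentially)
  define n where "n = N + k"
  define D :: "nat \<Rightarrow> real \<Rightarrow> real" where "D i = exp" for i
  define h where "h x = (\<Sum>m<n. (1 / fact m) * (a \<bullet> x) ^ m)" for x
  have h: "h \<in> Ck_limits k S"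
    unfolding h_def[abs_def] by (intro Ck_limits_sum Ck_limits_scale power_mem_Ck_limits) auto
  have "Ck_close k e (\<lambda>x. exp (a \<bullet> x)) h"
  proof (rule Ck_close_ridge[where a = a and E = "taylor_rem D n"])
    show "h \<in> Ck_on k (ball 0 1)" using h by (simp add: Ck_limits_def)
    show "exp (a \<bullet> x) - h x = taylor_rem D n 0 (a \<bullet> x)" for x
      by (simp add: h_def taylor_rem_def D_def)
    show "(taylor_rem D n i has_real_derivative taylor_rem D n (Suc i) y) (at y)" for i y
      by (intro DERIV_taylor_rem) (simp add: D_def)
    fix i y assume i: "i \<le> k" and y: "\<bar>y\<bar> \<le> norm a"
    have "\<bar>taylor_rem D n i y\<bar> \<le> exp R / fact (n - i) * \<bar>y\<bar> ^ (n - i)"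
      by (rule taylor_rem_bound[where \<rho> = R]) (use y R in \<open>auto simp: D_def\<close>)
    also have "\<dots> \<le> exp R / fact (n - i) * R ^ (n - i)"
      using y R by (intro mult_left_mono power_mono) auto
    finally have "\<bar>taylor_rem D n i y\<bar> * R ^ k \<le> exp R / fact (n - i) * R ^ (n - i) * R ^ k"
      using R by (intro mult_right_mono) auto
    also have "\<dots> \<le> e"
    proof -
      have "N \<le> n - i" using i by (simp add: n_def)
      from N[OF this] show ?thesis by simp
    qed
    finally show "\<bar>taylor_rem D n i y\<bar> * (1 + norm a) ^ k \<le> e" by (simp add: R_def)
  qed (rule Ck_on_exp_ridge)
  then show "\<exists>h\<in>Ck_limits k S. Ck_close k e (\<lambda>x. exp (a \<bullet> x)) h" using h by blast
qed (rule Ck_on_exp_ridge)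

end

section \<open>Convolution with sums of exponentials\<close>

inductive_set exp_sums :: "('a::euclidean_space \<Rightarrow> real) set" where
  exp_term: "(\<lambda>z. c * exp (v \<bullet> z)) \<in> exp_sums"
| add: "f \<in> exp_sums \<Longrightarrow> g \<in> exp_sums \<Longrightarrow> (\<lambda>z. f z + g z) \<in> exp_sums"

lemma exp_sums_continuous: "f \<in> exp_sums \<Longrightarrow> continuous_on A f"
  by (induction rule: exp_sums.induct) (auto intro!: continuous_intros)

lemma exp_sums_mult:
  assumes "f \<in> exp_sums" "g \<in> exp_sums"
  shows "(\<lambda>z. f z * g z) \<in> exp_sums"
  using assms(1)
proof (induction rule: exp_sums.induct)
  case (exp_term c v)
  show ?case using assms(2)
  proof (induction rule: exp_sums.induct)
    case (exp_term d w)
    have "(\<lambda>z. c * exp (v \<bullet> z) * (d * exp (w \<bullet> z))) = (\<lambda>z. (c * d) * exp ((v + w) \<bullet> z))"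
      by (simp add: inner_add_left exp_add mult_ac)
    then show ?case using exp_sums.exp_term by metis
  next
    case (add f g)
    then show ?case using exp_sums.add by (simp add: distrib_left)
  qed
next
  case (add f g)
  then show ?case using exp_sums.add by (simp add: distrib_right)
qed

text \<open>The Stone-Weierstrass theorem; \<open>z \<mapsto> exp ((x - y) \<bullet> z)\<close> separates \<open>x\<close> from \<open>y\<close>.\<close>

lemma exp_sums_dense:
  fixes \<rho> :: "'a::euclidean_space \<Rightarrow> real"
  assumes "compact K" "continuous_on K \<rho>" "0 < (e::real)"
  obtains q where "q \<in> exp_sums" "\<And>z. z \<in> K \<Longrightarrow> \<bar>\<rho> z - q z\<bar> < e"
proof -
  interpret function_ring_on "exp_sums :: ('a \<Rightarrow> real) set" K
  proof
    show "(\<lambda>_. c) \<in> (exp_sums :: ('a \<Rightarrow> real) set)" for c using exp_sums.exp_term[of c 0] by simp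
    show "\<exists>f\<in>exp_sums. f x \<noteq> f y" if "x \<in> K" "y \<in> K" "x \<noteq> y" for x y :: 'a
    proof (rule bexI[of _ "\<lambda>z. 1 * exp ((x - y) \<bullet> z)"])
      have "(x - y) \<bullet> x - (x - y) \<bullet> y = (x - y) \<bullet> (x - y)" by (simp add: inner_diff_right)
      moreover have "(x - y) \<bullet> (x - y) \<noteq> 0" using that by simp
      ultimately show "1 * exp ((x - y) \<bullet> x) \<noteq> 1 * exp ((x - y) \<bullet> y)" by auto
    qed (rule exp_sums.exp_term)
  qed (use assms exp_sums_continuous exp_sums_mult exp_sums.add in auto)
  show ?thesis using Stone_Weierstrass_basic[OF assms(2,3)] that by blast
qed

lemma bump_exists:
  assumes "0 < (\<delta>::real)" "\<delta> \<le> 1"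
  defines "K \<equiv> cbox (- 3 *\<^sub>R One) (3 *\<^sub>R One :: 'a::euclidean_space)"
  shows "\<exists>\<rho> :: 'a \<Rightarrow> real. continuous_on UNIV \<rho> \<and> (\<forall>z. 0 \<le> \<rho> z) \<and>
    (\<forall>z. \<delta> \<le> norm z \<longrightarrow> \<rho> z = 0) \<and> integral K \<rho> = 1"
proof -
  define f where "f z = max 0 (\<delta> - norm z)" for z :: 'a
  have c: "continuous_on A f" for A unfolding f_def[abs_def] by (intro continuous_intros)
  have i: "f integrable_on K" unfolding K_def by (intro integrable_continuous c)
  define I where "I = integral K f"
  have "I \<noteq> 0"
  proof
    assume "I = 0"
    then have "(f has_integral 0) K" using i by (simp add: I_def has_integral_iff)
    moreover have "box (- 3 *\<^sub>R One) (3 *\<^sub>R One :: 'a) \<noteq> {}" by (simp add: box_ne_empty)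
    moreover have "0 \<in> K" by (simp add: K_def mem_box)
    ultimately have "f 0 = 0" unfolding K_def
      using has_integral_0_cbox_imp_0[OF c, of "- 3 *\<^sub>R One" "3 *\<^sub>R One" 0] by (simp add: f_def)
    then show False using assms by (simp add: f_def)
  qed
  moreover have "0 \<le> I" unfolding I_def by (intro integral_nonneg i) (simp add: f_def)
  ultimately have I: "0 < I" by simp
  show ?thesis
  proof (intro exI[of _ "\<lambda>z. (1 / I) * f z"] conjI)
    show "continuous_on UNIV (\<lambda>z. (1 / I) * f z)" by (intro continuous_intros c)
    show "integral K (\<lambda>z. (1 / I) * f z) = 1" using I by (simp add: I_def[symmetric])
  qed (use I in \<open>auto simp: f_def\<close>)
qed

lemma integral_cbox_eq_lborel:
  fixes h :: "'a::euclidean_space \<Rightarrow> real"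
  assumes "continuous_on (cbox a b) h" "\<And>z. z \<notin> cbox a b \<Longrightarrow> h z = 0"
  shows "integral (cbox a b) h = (LINT z|lborel. h z)"
proof -
  have "set_integrable lborel (cbox a b) h"
    unfolding set_integrable_def using borel_integrable_compact[OF compact_cbox assms(1)] .
  from set_borel_integral_eq_integral(2)[OF this]
  have "integral (cbox a b) h = (LINT z|lborel. indicator (cbox a b) z *\<^sub>R h z)"
    by (simp add: set_lebesgue_integral_def)
  also have "\<dots> = (LINT z|lborel. h z)"
    using assms(2) by (intro Bochner_Integration.integral_cong) (auto simp: indicator_def)
  finally show ?thesis .
qed

text \<open>For \<open>x\<close> in the unit ball and \<open>F\<close> supported in the ball of radius \<open>2\<close>, both integrands vanish outside the
  box, which contains the ball of radius \<open>3\<close>. The left-hand side is the form in which derivatives fall on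
  \<open>F\<close>, the right-hand side the one in which \<open>x\<close> enters through \<open>q\<close> only.\<close>

lemma convolution_commute:
  fixes F q :: "'a::euclidean_space \<Rightarrow> real"
  assumes F: "continuous_on UNIV F" "\<And>y. 2 \<le> norm y \<Longrightarrow> F y = 0" and q: "continuous_on UNIV q"
    and x: "norm x < 1"
  defines "K \<equiv> cbox (- 3 *\<^sub>R One) (3 *\<^sub>R One :: 'a)"
  shows "integral K (\<lambda>z. F (x - z) * q z) = integral K (\<lambda>y. F y * q (x - y))"
proof -
  have K: "z \<in> K" if "norm z < 3" for z :: 'a
    using that Basis_le_norm[of _ z] by (force simp: K_def mem_box)
  have c: "continuous_on A (\<lambda>z. F (x - z) * q z)" "continuous_on A (\<lambda>y. F y * q (x - y))" for A
    by (auto intro!: continuous_intros continuous_on_compose2[OF F(1)] continuous_on_compose2[OF q])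
  have m: "(\<lambda>y. F y * q (x - y)) \<in> borel_measurable borel"
    using c(2)[of UNIV] by (rule borel_measurable_continuous_onI)
  have "integral K (\<lambda>z. F (x - z) * q z) = (LINT z|lborel. F (x - z) * q z)"
    unfolding K_def
  proof (rule integral_cbox_eq_lborel[OF c(1)])
    fix z assume "z \<notin> cbox (- 3 *\<^sub>R One) (3 *\<^sub>R One :: 'a)"
    then have "3 \<le> norm z" using K[of z] unfolding K_def by force
    then have "2 \<le> norm (x - z)" using x norm_triangle_ineq2[of z x] by (simp add: norm_minus_commute)
    then show "F (x - z) * q z = 0" using F(2) by simp
  qed
  also have "\<dots> = (LINT y|lborel. F y * q (x - y))"
    using lborel_integral_flip(2)[OF m, of x] by simp
  also have "\<dots> = integral K (\<lambda>y. F y * q (x - y))"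
    unfolding K_def
  proof (rule integral_cbox_eq_lborel[OF c(2), symmetric])
    fix z assume "z \<notin> cbox (- 3 *\<^sub>R One) (3 *\<^sub>R One :: 'a)"
    then have "3 \<le> norm z" using K[of z] unfolding K_def by force
    then show "F z * q (x - z) = 0" using F(2) by simp
  qed
  finally show ?thesis .
qed

text \<open>Two errors: replacing \<open>q\<close> by the bump \<open>\<rho>\<close> costs at most the bound of \<open>G\<close> times \<open>e'\<close> times the
  volume of the box, and averaging \<open>G\<close> against \<open>\<rho>\<close> costs its oscillation at distance \<open>\<delta>\<close>.\<close>

lemma mollification_error:
  fixes G q \<rho> :: "'a::euclidean_space \<Rightarrow> real"
  defines "K \<equiv> cbox (- 3 *\<^sub>R One) (3 *\<^sub>R One :: 'a)"
  assumes G: "continuous_on UNIV G" and q: "continuous_on UNIV q" and \<rho>: "continuous_on UNIV \<rho>" 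
    and "\<And>z. 0 \<le> \<rho> z" "\<And>z. \<delta> \<le> norm z \<Longrightarrow> \<rho> z = 0" "integral K \<rho> = 1"
    and osc: "\<And>z. norm z < \<delta> \<Longrightarrow> \<bar>G (x - z) - G x\<bar> \<le> e"
    and C: "\<And>z. z \<in> K \<Longrightarrow> \<bar>G (x - z)\<bar> \<le> C"
    and qe: "\<And>z. z \<in> K \<Longrightarrow> \<bar>\<rho> z - q z\<bar> \<le> e'"
  shows "\<bar>integral K (\<lambda>z. G (x - z) * q z) - G x\<bar> \<le> e + C * e' * measure lborel K"
proof -
  have cG: "continuous_on A (\<lambda>z. G (x - z))" for A
    by (auto intro!: continuous_intros continuous_on_compose2[OF G])
  have c: "continuous_on A q" "continuous_on A \<rho>" for A using q \<rho> continuous_on_subset by blast+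
  have int: "f integrable_on K" if "continuous_on K f" for f :: "'a \<Rightarrow> real"
    using that unfolding K_def by (rule integrable_continuous)
  have 1: "integral K (\<lambda>z. G (x - z) * q z) - G x
     = integral K (\<lambda>z. G (x - z) * (q z - \<rho> z)) + integral K (\<lambda>z. (G (x - z) - G x) * \<rho> z)"
  proof -
    have "integral K (\<lambda>z. G (x - z) * (q z - \<rho> z)) + integral K (\<lambda>z. (G (x - z) - G x) * \<rho> z)
      = integral K (\<lambda>z. G (x - z) * (q z - \<rho> z) + (G (x - z) - G x) * \<rho> z)"
      by (intro Henstock_Kurzweil_Integration.integral_add[symmetric] int continuous_intros cG c)
    also have "\<dots> = integral K (\<lambda>z. G (x - z) * q z - G x * \<rho> z)"
      by (intro integral_cong) (simp add: algebra_simps)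
    also have "\<dots> = integral K (\<lambda>z. G (x - z) * q z) - integral K (\<lambda>z. G x * \<rho> z)"
      by (intro Henstock_Kurzweil_Integration.integral_diff int continuous_intros cG c)
    finally show ?thesis using \<open>integral K \<rho> = 1\<close> by simp
  qed
  have "\<bar>integral K (\<lambda>z. G (x - z) * (q z - \<rho> z))\<bar> \<le> integral K (\<lambda>z. C * e')"
    unfolding real_norm_def[symmetric]
  proof (rule integral_norm_bound_integral)
    show "norm (G (x - z) * (q z - \<rho> z)) \<le> C * e'" if "z \<in> K" for z
      unfolding real_norm_def abs_mult using C[OF that] qe[OF that] 
      by (intro mult_mono) (auto simp: abs_minus_commute)
  qed (auto intro!: int continuous_intros cG c)
  moreover have "integral K (\<lambda>z. C * e') = C * e' * measure lborel K" by (simp add: K_def)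
  moreover have "\<bar>integral K (\<lambda>z. (G (x - z) - G x) * \<rho> z)\<bar> \<le> integral K (\<lambda>z. e * \<rho> z)"
    unfolding real_norm_def[symmetric]
  proof (rule integral_norm_bound_integral)
    show "norm ((G (x - z) - G x) * \<rho> z) \<le> e * \<rho> z" for z
      using assms(5)[of z] assms(6)[of z] osc[of z]
      by (cases "norm z < \<delta>") (auto simp: abs_mult intro!: mult_right_mono)
  qed (auto intro!: int continuous_intros cG c)
  moreover have "integral K (\<lambda>z. e * \<rho> z) = e" using \<open>integral K \<rho> = 1\<close> by simp
  ultimately show ?thesis unfolding 1 by linarith
qed

context plane_wave_span
begin

text \<open>Since \<open>exp (v \<bullet> (x - y))\<close> is a product of a function of \<open>x\<close> and a function of \<open>y\<close>, integrating over \<open>y\<close> only changes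
  the coefficient of \<open>exp (v \<bullet> x)\<close>.\<close>

lemma exp_convolution_mem:
  assumes "q \<in> exp_sums" "continuous_on UNIV F"
  shows "(\<lambda>x. integral (cbox a b) (\<lambda>y. F y * q (x - y))) \<in> Ck_limits k S"
  using assms(1)
proof (induction rule: exp_sums.induct)
  case (exp_term c v)
  have "(\<lambda>x. integral (cbox a b) (\<lambda>y. F y * (c * exp (v \<bullet> (x - y)))))
    = (\<lambda>x. integral (cbox a b) (\<lambda>y. F y * (c * exp (- (v \<bullet> y)))) * exp (v \<bullet> x))"
    by (simp add: inner_diff_right exp_diff exp_minus divide_inverse flip: integral_mult_left)
      (simp add: mult_ac)
  then show ?case using Ck_limits_scale[OF exp_mem_Ck_limits] by simp
next
  case (add f g)
  have "integral (cbox a b) (\<lambda>y. F y * (f (x - y) + g (x - y)))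
     = integral (cbox a b) (\<lambda>y. F y * f (x - y)) + integral (cbox a b) (\<lambda>y. F y * g (x - y))" for x
    unfolding distrib_left
    by (intro Henstock_Kurzweil_Integration.integral_add integrable_continuous continuous_on_mult 
        continuous_on_subset[OF assms(2)] continuous_on_compose2[OF exp_sums_continuous[OF add(1)]]
        continuous_on_compose2[OF exp_sums_continuous[OF add(2)]])
      (auto intro!: continuous_intros)
  then show ?case using Ck_limits_lincomb[OF add.IH, of 1 1] by simp
qed

text \<open>The order of the choices matters: the moduli of continuity of the derivatives of \<open>F\<close> determine the radius \<open>\<delta>\<close> of the
  bump, and only then is \<open>q\<close> chosen close to this bump, with an accuracy that depends on the bounds of these
  derivatives.\<close>

proposition compactly_supported_mem_Ck_limits:
  assumes F: "F \<in> Ck_on k UNIV" and supp: "\<And>y. 2 \<le> norm y \<Longrightarrow> F y = 0"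
  shows "F \<in> Ck_limits k S"
proof (rule Ck_limits_closed)
  show "F \<in> Ck_on k (ball 0 1)" using Ck_on_subset[OF F] by simp
  fix e :: real assume e: "e > 0"
  define K where "K = cbox (- 3 *\<^sub>R One) (3 *\<^sub>R One :: 'a)"
  define L where "L = {bs. set bs \<subseteq> (Basis :: 'a set) \<and> length bs \<le> k}"
  have L: "finite L" unfolding L_def by (intro finite_lists_length_le) simp
  have cont: "continuous_on A (iter_partial bs F)" if "bs \<in> L" for bs A
    using Ck_on_iter_continuous[OF F] that continuous_on_subset[of UNIV _ A] by (auto simp: L_def)
  have cF: "continuous_on UNIV F" using Ck_on_iter_continuous[OF F, of "[]"] by simp
  have "\<forall>\<^sub>F \<delta> in at_right 0. \<forall>bs\<in>L. \<forall>x\<in>cball 0 2. \<forall>x'\<in>cball 0 2. dist x' x < \<delta> \<longrightarrow> dist (iter_partial bs F x') (iter_partial bs F x) < e/2"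
  proof (rule eventually_ball_finite[OF L], rule ballI)
    fix bs assume "bs \<in> L"
    then have "uniformly_continuous_on (cball 0 2) (iter_partial bs F)"
      by (intro compact_uniformly_continuous cont) auto
    then obtain d where "d > 0" "\<forall>x\<in>cball 0 2. \<forall>x'\<in>cball 0 2. dist x' x < d \<longrightarrow> dist (iter_partial bs F x') (iter_partial bs F x) < e/2"
      unfolding uniformly_continuous_on_def using e by (metis half_gt_zero)
    then show "\<forall>\<^sub>F \<delta> in at_right 0. \<forall>x\<in>cball 0 2. \<forall>x'\<in>cball 0 2. dist x' x < \<delta> \<longrightarrow> dist (iter_partial bs F x') (iter_partial bs F x) < e/2"
      unfolding eventually_at_right_field by (auto intro!: exI[of _ d])
  qed
  then obtain d where d: "d > 0" "\<And>\<delta>. 0 < \<delta> \<Longrightarrow> \<delta> < d \<Longrightarrow> \<forall>bs\<in>L. \<forall>x\<in>cball 0 2. \<forall>x'\<in>cball 0 2. dist x' x < \<delta> \<longrightarrow> dist (iter_partial bs F x') (iter_partial bs F x) < e/2"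
    unfolding eventually_at_right_field by blast
  define \<delta> where "\<delta> = min 1 (d / 2)"
  have \<delta>: "0 < \<delta>" "\<delta> \<le> 1" "\<delta> < d" using d(1) by (auto simp: \<delta>_def)
  have osc: "\<bar>iter_partial bs F (x - z) - iter_partial bs F x\<bar> \<le> e/2" if "bs \<in> L" "norm x < 1" "norm z < \<delta>" for bs x z
  proof -
    have "norm (x - z) \<le> 2" using norm_triangle_ineq4[of x z] that \<delta> by linarith
    then have "x - z \<in> cball 0 2" "x \<in> cball 0 2" "dist (x - z) x < \<delta>"
      using that by (simp_all add: mem_cball_0 dist_norm del: mem_cball)
    then have "dist (iter_partial bs F (x - z)) (iter_partial bs F x) < e/2"
      using d(2)[OF \<delta>(1,3)] that(1) by blast
    then show ?thesis by (simp add: dist_norm)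
  qed
  obtain m where m: "\<And>z. z \<in> K \<Longrightarrow> norm z \<le> m"
    using bounded_cbox[of "- 3 *\<^sub>R One" "3 *\<^sub>R One :: 'a"] unfolding K_def bounded_iff by blast
  have "\<exists>C. \<forall>y\<in>cball 0 (1 + m). \<bar>iter_partial bs F y\<bar> \<le> C" if "bs \<in> L" for bs
  proof -
    have "compact (iter_partial bs F ` cball 0 (1 + m))" by (intro compact_continuous_image cont that) auto
    then show ?thesis using compact_imp_bounded bounded_iff by (metis imageI real_norm_def)
  qed
  then obtain C where C: "\<And>bs y. bs \<in> L \<Longrightarrow> y \<in> cball 0 (1 + m) \<Longrightarrow> \<bar>iter_partial bs F y\<bar> \<le> C bs" by metis
  define C' where "C' = (\<Sum>bs\<in>L. \<bar>C bs\<bar>)"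
  have C': "0 \<le> C'" by (simp add: C'_def sum_nonneg)
  have bound: "\<bar>iter_partial bs F (x - z)\<bar> \<le> C'" if "bs \<in> L" "norm x < 1" "z \<in> K" for bs x z
  proof -
    have "norm (x - z) \<le> 1 + m" using norm_triangle_ineq4[of x z] that m[of z] by linarith
    then have "\<bar>iter_partial bs F (x - z)\<bar> \<le> \<bar>C bs\<bar>" using C[OF that(1), of "x - z"] by force
    also have "\<dots> \<le> C'" unfolding C'_def using that(1) L by (intro member_le_sum) auto
    finally show ?thesis .
  qed
  define V where "V = measure lborel K"
  define e' where "e' = e / (2 * (C' * V + 1))"
  have V: "0 \<le> C' * V" using C' by (simp add: V_def)
  have e': "0 < e'" "C' * e' * V \<le> e / 2" using V e by (auto simp: e'_def field_simps)
  obtain \<rho> :: "'a \<Rightarrow> real" where \<rho>': "continuous_on UNIV \<rho> \<and> (\<forall>z. 0 \<le> \<rho> z) \<and>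
    (\<forall>z. \<delta> \<le> norm z \<longrightarrow> \<rho> z = 0) \<and> integral K \<rho> = 1"
    using bump_exists[OF \<delta>(1,2), where 'a='a, folded K_def] ..
  have \<rho>: "continuous_on UNIV \<rho>" "\<And>z. 0 \<le> \<rho> z" "\<And>z. \<delta> \<le> norm z \<Longrightarrow> \<rho> z = 0" "integral K \<rho> = 1"
    using \<rho>' by auto
  have "compact K" "continuous_on K \<rho>" using \<rho>(1) continuous_on_subset by (auto simp: K_def)
  then obtain q where q: "q \<in> exp_sums" "\<And>z. z \<in> K \<Longrightarrow> \<bar>\<rho> z - q z\<bar> < e'"
    using exp_sums_dense e'(1) by blast
  have cq: "continuous_on A q" for A using q(1) by (rule exp_sums_continuous)
  define P where "P x = integral K (\<lambda>z. F (x - z) * q z)" for x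
  have "(\<lambda>x. integral K (\<lambda>y. F y * q (x - y))) \<in> Ck_limits k S"
    unfolding K_def by (rule exp_convolution_mem[OF q(1) cF])
  then have "P \<in> Ck_limits k S"
    using convolution_commute[OF cF supp cq] unfolding P_def K_def
    by (elim Ck_limits_cong[rotated]) simp
  moreover have "Ck_close k e F P"
  proof (rule Ck_closeI)
    fix bs :: "'a list" and x :: 'a assume bs: "set bs \<subseteq> Basis" "length bs \<le> k" and "x \<in> ball 0 1"
    then have x: "norm x < 1" and L': "bs \<in> L" by (auto simp: L_def)
    have "iter_partial bs P x = integral K (\<lambda>z. iter_partial bs F (x - z) * q z)"
      unfolding P_def[abs_def] K_def by (subst iter_partial_convolution[OF F cq bs]) simp
    moreover have "\<bar>integral K (\<lambda>z. iter_partial bs F (x - z) * q z) - iter_partial bs F x\<bar> \<le> e / 2 + C' * e' * measure lborel K"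
      unfolding K_def
      by (rule mollification_error[OF cont[OF L'] cq \<rho>(1-3)])
        (use \<rho>(4) osc[OF L' x] bound[OF L' x] q(2) in \<open>auto simp: K_def less_imp_le\<close>)
    ultimately show "\<bar>iter_partial bs F x - iter_partial bs P x\<bar> \<le> e"
      using e'(2) by (simp add: V_def abs_minus_commute)
  qed
  ultimately show "\<exists>h\<in>Ck_limits k S. Ck_close k e F h" by blast
qed

end

section \<open>Cutoff and dilation\<close>

lemma Ck_on_norm_square: "(\<lambda>x. x \<bullet> x) \<in> Ck_on k (UNIV :: 'a::euclidean_space set)"
proof (cases k)
  case 0
  then show ?thesis by (simp add: Ck_on_0 continuous_intros)
next
  case (Suc j)
  show ?thesis unfolding Suc
  proof (rule Ck_on_SucI[where \<psi> = "\<lambda>b x. 2 * (b \<bullet> x)"])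
    show "((\<lambda>t. (x + t *\<^sub>R b) \<bullet> (x + t *\<^sub>R b)) has_real_derivative 2 * (b \<bullet> x)) (at 0)" for x b :: 'a
      unfolding inner_add_left inner_add_right inner_scaleR_left inner_scaleR_right
      by (auto intro!: derivative_eq_intros simp: inner_commute)
    show "(\<lambda>x. 2 * (b \<bullet> x)) \<in> Ck_on j UNIV" for b :: 'a
      using Ck_on_ridge[of UNIV UNIV "\<lambda>i y. if i = 0 then 2 * y else if i = 1 then 2 else 0" b j]
      by (auto intro!: derivative_eq_intros)
  qed (auto intro!: continuous_intros)
qed

lemma Ck_on_const: "(\<lambda>x. c) \<in> Ck_on k (UNIV :: 'a::euclidean_space set)"
  using Ck_on_ridge[of UNIV UNIV "\<lambda>i y. if i = 0 then c else 0" "0::'a" k] by simp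

text \<open>With \<open>g x = (|x| ^ 2 - 1) / (r ^ 2 - 1)\<close>, which is nonpositive on the unit ball and at least \<open>1\<close> outside radius \<open>r\<close>, the
  function \<open>(1 - g\<^sub>+ ^ (k + 1))\<^sub>+ ^ (k + 1)\<close> has class \<open>C\<^sup>k\<close>, because each power of a positive part does.\<close>

lemma cutoff_exists:
  assumes "1 < r"
  obtains \<eta> :: "'a::euclidean_space \<Rightarrow> real" where "\<eta> \<in> Ck_on k UNIV"
    "\<And>x. norm x \<le> 1 \<Longrightarrow> \<eta> x = 1" "\<And>x. r \<le> norm x \<Longrightarrow> \<eta> x = 0"
proof -
  define c where "c = 1 / (r\<^sup>2 - 1)"
  have r2: "1 < r\<^sup>2" using assms by (simp add: one_less_power)
  define g where "g x = c * (x \<bullet> x) + (- c) * 1" for x :: 'a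
  define h where "h x = 1 * 1 + (- 1) * max 0 (g x) ^ Suc k" for x
  define \<eta> where "\<eta> x = max 0 (h x) ^ Suc k" for x
  have "g \<in> Ck_on k UNIV" unfolding g_def[abs_def]
    by (intro Ck_on_lincomb Ck_on_norm_square Ck_on_const open_UNIV)
  then have "h \<in> Ck_on k UNIV" unfolding h_def[abs_def]
    by (intro Ck_on_lincomb Ck_on_const Ck_on_pos_part_power open_UNIV) auto
  then have "\<eta> \<in> Ck_on k UNIV" unfolding \<eta>_def[abs_def]
    by (intro Ck_on_pos_part_power) auto
  moreover have "\<eta> x = 1" if "norm x \<le> 1" for x
  proof -
    have "x \<bullet> x \<le> 1" using that by (simp add: dot_square_norm power_le_one)
    then have "c * (x \<bullet> x) \<le> c * 1" using r2 by (intro mult_left_mono) (auto simp: c_def)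
    then show ?thesis by (simp add: \<eta>_def h_def g_def max_absorb1)
  qed
  moreover have "\<eta> x = 0" if "r \<le> norm x" for x
  proof -
    have "r\<^sup>2 \<le> x \<bullet> x" using that assms by (simp add: dot_square_norm power_mono)
    then have "c * (r\<^sup>2 - 1) \<le> c * (x \<bullet> x - 1)" using r2 by (intro mult_left_mono) (auto simp: c_def)
    moreover have "c * (r\<^sup>2 - 1) = 1" using r2 by (simp add: c_def)
    ultimately have "1 \<le> g x" by (simp add: g_def right_diff_distrib)
    then have "1 \<le> max 0 (g x) ^ Suc k" by (intro one_le_power) auto
    then show ?thesis by (simp add: \<eta>_def h_def max_absorb1)
  qed
  ultimately show ?thesis by (rule that)
qed

context plane_wave_span
begin

lemma dilation_mem_Ck_limits:
  assumes f: "f \<in> Ck_on k (ball 0 1)" and l: "1/2 < l" "l < 1"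
  shows "(\<lambda>x. f (l *\<^sub>R x)) \<in> Ck_limits k S"
proof -
  define r where "r = 1 / l"
  have r: "1 < r" "r < 2" using l by (auto simp: r_def field_simps)
  have V: "(\<lambda>x. l *\<^sub>R x) -` ball 0 1 = (ball 0 r :: 'a set)"
    using l by (auto simp: r_def field_simps)
  have fl: "(\<lambda>x. f (l *\<^sub>R x)) \<in> Ck_on k (ball 0 r)"
    using Ck_on_dilation[OF open_ball f, of l] l unfolding V by simp
  \<comment> \<open>a radius between \<open>1\<close> and \<open>r\<close>, so that the cutoff vanishes before \<open>f (l x)\<close> ceases to be defined\<close>
  define r' where "r' = (1 + r) / 2"
  have r': "1 < r'" "r' < r" using r by (auto simp: r'_def)
  obtain \<eta> :: "'a \<Rightarrow> real" where \<eta>: "\<eta> \<in> Ck_on k UNIV" "\<And>x. norm x \<le> 1 \<Longrightarrow> \<eta> x = 1"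
    "\<And>x. r' \<le> norm x \<Longrightarrow> \<eta> x = 0"
    using cutoff_exists[OF r'(1)] by blast
  define F where "F x = (if x \<in> ball 0 r then f (l *\<^sub>R x) * \<eta> x else 0)" for x
  define W where "W = - cball (0::'a) r'"
  have W: "open W" by (simp add: W_def open_Compl)
  have 1: "(\<lambda>x. f (l *\<^sub>R x) * \<eta> x) \<in> Ck_on k (ball 0 r)"
    by (intro Ck_on_mult fl Ck_on_subset[OF \<eta>(1)]) auto
  have "F \<in> Ck_on k (ball 0 r)"
    using Ck_on_cong[of "ball 0 r" F "\<lambda>x. f (l *\<^sub>R x) * \<eta> x" k] 1 by (simp add: F_def)
  moreover have "F \<in> Ck_on k W"
    using Ck_on_cong[OF W, of F "\<lambda>_. 0" k] Ck_on_subset[OF Ck_on_const, of W 0 k] \<eta>(3)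
    by (simp add: F_def W_def)
  moreover have "ball 0 r \<union> W = UNIV" using r' by (auto simp: W_def)
  ultimately have "F \<in> Ck_on k UNIV" using Ck_on_Un[OF open_ball W] by metis
  then have "F \<in> Ck_limits k S"
    by (rule compactly_supported_mem_Ck_limits) (use r in \<open>auto simp: F_def\<close>)
  then show ?thesis
    by (rule Ck_limits_cong[rotated]) (use r \<eta>(2) in \<open>auto simp: F_def\<close>)
qed

end

text \<open>A derivative of order \<open>i\<close> of \<open>f(l x)\<close> is \<open>l ^ i\<close> times the derivative of \<open>f\<close> at \<open>l x\<close>. It converges uniformly as \<open>l\<close> tends to \<open>1\<close>, as the
  derivatives of \<open>f\<close> are uniformly continuous, hence bounded, on the ball.\<close>

lemma dilation_close:
  fixes f :: "'a::euclidean_space \<Rightarrow> real"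
  assumes f: "f \<in> Ck_closure k (ball 0 1)" and "0 < e"
  obtains l where "1/2 < l" "l < 1" "Ck_close k e f (\<lambda>x. f (l *\<^sub>R x))"
proof -
  have Ck: "f \<in> Ck_on k (ball 0 1)" using f by (simp add: Ck_closure_def)
  have "\<forall>\<^sub>F l in at_left 1. \<forall>\<alpha>\<in>multi_indices k. \<forall>x\<in>ball 0 1. \<bar>multi_deriv \<alpha> f x - multi_deriv \<alpha> (\<lambda>x. f (l *\<^sub>R x)) x\<bar> \<le> e"
  proof (rule eventually_ball_finite[OF finite_multi_indices], rule ballI)
    fix \<alpha> :: "'a multiset" assume \<alpha>: "\<alpha> \<in> multi_indices k"
    obtain bs where bs: "set bs \<subseteq> Basis" "length bs \<le> k" "multi_deriv \<alpha> = iter_partial bs"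
      using multi_deriv_list[OF \<alpha>] .
    define G where "G = iter_partial bs f"
    have G: "uniformly_continuous_on (ball 0 1) G"
      using f \<alpha> unfolding Ck_closure_def G_def bs(3)[symmetric] by auto
    have "bounded (G ` ball 0 1)"
      by (rule bounded_uniformly_continuous_image[OF G]) simp
    then obtain C where C: "\<And>x. x \<in> ball 0 1 \<Longrightarrow> \<bar>G x\<bar> \<le> C"
      unfolding bounded_iff by (metis imageI real_norm_def)
    obtain d where d: "d > 0" "\<And>x x'. x \<in> ball 0 1 \<Longrightarrow> x' \<in> ball 0 1 \<Longrightarrow> dist x' x < d \<Longrightarrow> dist (G x') (G x) < e/2"
      using G assms(2) unfolding uniformly_continuous_on_def by (metis half_gt_zero)
    have "((\<lambda>l. (1 - l ^ length bs) * C) \<longlongrightarrow> (1 - 1 ^ length bs) * C) (at_left 1)"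
      by (intro tendsto_intros)
    then have "\<forall>\<^sub>F l in at_left 1. (1 - l ^ length bs) * C < e / 2"
      using assms(2) by (intro order_tendstoD(2)) auto
    moreover have "\<forall>\<^sub>F l in at_left (1::real). max (1/2) (1 - d) < l"
      by (rule eventually_mono[OF eventually_at_left_real[of "max (1/2) (1 - d)" 1]]) (use d(1) in auto)
    moreover have "\<forall>\<^sub>F l in at_left (1::real). l < 1" by (simp add: eventually_at_filter)
    ultimately show "\<forall>\<^sub>F l in at_left 1. \<forall>x\<in>ball 0 1. \<bar>multi_deriv \<alpha> f x - multi_deriv \<alpha> (\<lambda>x. f (l *\<^sub>R x)) x\<bar> \<le> e"
    proof eventually_elim
      case (elim l)
      show ?case
      proof
        fix x :: 'a assume x: "x \<in> ball 0 1"
        have nl: "norm (l *\<^sub>R x) \<le> norm x" using elim by (simp add: mult_left_le_one_le)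
        then have lx: "l *\<^sub>R x \<in> ball 0 1" using x by simp
        have 1: "multi_deriv \<alpha> (\<lambda>x. f (l *\<^sub>R x)) x = l ^ length bs * G (l *\<^sub>R x)"
          unfolding bs(3) G_def
          using iter_partial_dilation[OF open_ball Ck, of l bs x] bs lx elim by simp
        have "dist (l *\<^sub>R x) x = (1 - l) * norm x"
        proof -
          have "l *\<^sub>R x - x = - ((1 - l) *\<^sub>R x)" by (simp add: algebra_simps)
          then show ?thesis using elim by (simp add: dist_norm)
        qed
        also have "\<dots> \<le> (1 - l) * 1" using x elim by (intro mult_left_mono) auto
        finally have "dist (l *\<^sub>R x) x < d" using elim by simp
        then have 2: "\<bar>G (l *\<^sub>R x) - G x\<bar> < e/2" using d(2)[OF x lx] by (simp add: dist_norm)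
        have l1: "l ^ length bs \<le> 1" using elim by (intro power_le_one) auto
        have "\<bar>(1 - l ^ length bs) * G (l *\<^sub>R x)\<bar> \<le> (1 - l ^ length bs) * C"
          using C[OF lx] l1 by (simp add: abs_mult mult_left_mono)
        then have 3: "\<bar>(1 - l ^ length bs) * G (l *\<^sub>R x)\<bar> < e/2" using elim by simp
        have "multi_deriv \<alpha> f x - multi_deriv \<alpha> (\<lambda>x. f (l *\<^sub>R x)) x
          = - (G (l *\<^sub>R x) - G x) + (1 - l ^ length bs) * G (l *\<^sub>R x)"
          unfolding 1 by (simp add: bs(3) G_def algebra_simps)
        then show "\<bar>multi_deriv \<alpha> f x - multi_deriv \<alpha> (\<lambda>x. f (l *\<^sub>R x)) x\<bar> \<le> e"
          using 2 3 by linarith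
      qed
    qed
  qed
  moreover have "\<forall>\<^sub>F l in at_left (1::real). l \<in> {1/2<..<1}" by (rule eventually_at_left_real) simp
  ultimately have "\<forall>\<^sub>F l in at_left 1. 1/2 < l \<and> l < 1 \<and> Ck_close k e f (\<lambda>x. f (l *\<^sub>R x))"
    by eventually_elim (simp add: Ck_close_def)
  from eventually_happens'[OF trivial_limit_at_left_real this] show ?thesis using that by blast
qed

section \<open>Density of the span\<close>

context plane_wave_span
begin

theorem Ck_closure_subset_Ck_limits: "Ck_closure k (ball 0 1) \<subseteq> Ck_limits k S"
proof
  fix f :: "'a \<Rightarrow> real" assume f: "f \<in> Ck_closure k (ball 0 1)"
  then have Ck: "f \<in> Ck_on k (ball 0 1)" by (simp add: Ck_closure_def)
  show "f \<in> Ck_limits k S"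
    using Ck dilation_close[OF f] dilation_mem_Ck_limits[OF Ck] by (intro Ck_limits_closed) metis+
qed

end

theorem theorem1:
  fixes s p \<epsilon> :: real and k :: nat
    and f :: "'a::euclidean_space \<Rightarrow> real"
    and M :: "('a \<Rightarrow> real) set"
  assumes "0 < s" and "s < 1" and "1 < p"
    and "M = {u. p_harmonic_in_unit_ball s p u}"
    and "f \<in> Ck_closure k (ball 0 1)"
    and "\<epsilon> > 0"
  shows "\<exists>u \<in> fun_span M.
           (\<lambda>x. f x - u x) \<in> Ck_closure k (ball 0 1) \<and>
           Ck_norm k (ball 0 1) (\<lambda>x. f x - u x) < \<epsilon>"
proof -
  interpret frac_exponents s p using assms by unfold_locales
  interpret V: vector_space "fun_scale :: real \<Rightarrow> ('a \<Rightarrow> real) \<Rightarrow> 'a \<Rightarrow> real" by (rule vector_space_fun_scale)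
  define S where "S = fun_span M"
  have lin: "(\<lambda>x. c * u x + d * v x) \<in> S" if "u \<in> S" "v \<in> S" for u v c d
  proof -
    have "(\<lambda>x. c * u x) + (\<lambda>x. d * v x) \<in> S"
      using that unfolding S_def by (intro V.span_add V.span_scale)
    then show ?thesis by (simp add: plus_fun_def)
  qed
  have wave: "p_harmonic_in_unit_ball s p (\<lambda>x. max 0 (1 + a \<bullet> x) powr s)" if a: "norm a < 1" for a :: 'a
    unfolding p_harmonic_in_unit_ball_def
  proof (intro conjI exI ballI allI)
    define U where "U = {x. 0 < 1 + a \<bullet> x}"
    show U: "open U" unfolding U_def by (intro open_Collect_less continuous_intros)
    have pos: "0 < 1 + a \<bullet> x" if "norm x \<le> 1" for x
    proof -
      have "norm a * norm x \<le> norm a * 1" using that by (intro mult_left_mono) auto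
      then show ?thesis using Cauchy_Schwarz_ineq2[of a x] a by auto
    qed
    then show "cball 0 1 \<subseteq> U" by (auto simp: U_def)
    show "has_frac_p_laplacian s p (\<lambda>x. max 0 (1 + a \<bullet> x) powr s) x 0" if "x \<in> ball 0 1" for x
      using that by (intro plane_wave_has_zero_laplacian pos) simp
    show "continuous_on UNIV (\<lambda>x. max 0 (1 + a \<bullet> x) powr s)"
      using s_pos by (intro continuous_on_powr' continuous_intros) auto
    show "(\<lambda>x. max 0 (1 + a \<bullet> x) powr s) \<in> Ck_on j U" for j
    proof -
      have "(\<lambda>x. powr_derivs s 0 (a \<bullet> x)) \<in> Ck_on j U"
        by (rule Ck_on_ridge[OF U, of "{-1<..}"]) (auto simp: U_def intro: DERIV_powr_derivs)
      then show ?thesis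
        using Ck_on_cong[OF U, of "\<lambda>x. max 0 (1 + a \<bullet> x) powr s" "\<lambda>x. powr_derivs s 0 (a \<bullet> x)" j]
        by (simp add: U_def powr_derivs_def)
    qed
  qed
  interpret plane_wave_span S s k
  proof
    show "S \<noteq> {}" using V.span_zero unfolding S_def by blast
    show "(\<lambda>x. max 0 (1 + a \<bullet> x) powr s) \<in> S" if "norm a < 1" for a
      unfolding S_def using wave[OF that] assms(4) by (intro V.span_base) simp
  qed (use lin assms in auto)
  \<comment> \<open>Regularity on a neighbourhood of the closed ball makes the derivatives of \<open>u\<close> uniformly continuous on the open ball.\<close>
  have smooth: "\<exists>W. open W \<and> cball 0 1 \<subseteq> W \<and> u \<in> Ck_on k W" if "u \<in> S" for u
    using that unfolding S_def
  proof (induction rule: V.span_induct_alt)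
    case base
    show ?case using Ck_on_const[of 0 k] by (intro exI[of _ UNIV]) (simp add: zero_fun_def)
  next
    case (step c u v)
    obtain W1 where W1: "open W1" "cball 0 1 \<subseteq> W1" "u \<in> Ck_on k W1"
      using step(1) assms(4) unfolding p_harmonic_in_unit_ball_def by blast
    obtain W2 where W2: "open W2" "cball 0 1 \<subseteq> W2" "v \<in> Ck_on k W2" using step by blast
    have "(\<lambda>x. c * u x + 1 * v x) \<in> Ck_on k (W1 \<inter> W2)"
      using W1 W2 by (intro Ck_on_lincomb) (auto intro: Ck_on_subset)
    then show ?case using W1 W2 by (intro exI[of _ "W1 \<inter> W2"]) (auto simp: plus_fun_def)
  qed
  define N where "N = real (card (multi_indices k :: 'a multiset set))"
  define e where "e = \<epsilon> / (N + 1)"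
  have e: "0 < e" "N * e < \<epsilon>" using assms(6) by (auto simp: e_def N_def field_simps)
  have fCk: "f \<in> Ck_on k (ball 0 1)" using assms(5) by (simp add: Ck_closure_def)
  obtain u where u: "u \<in> S" "u \<in> Ck_on k (ball 0 1)" "Ck_close k e f u"
    using Ck_closure_subset_Ck_limits assms(5) e(1) unfolding Ck_limits_def by blast
  have diff: "multi_deriv \<alpha> (\<lambda>x. f x - u x) x = multi_deriv \<alpha> f x - multi_deriv \<alpha> u x"
    if "\<alpha> \<in> multi_indices k" "x \<in> ball 0 1" for \<alpha> x
    using multi_deriv_lincomb[OF that(1) open_ball fCk u(2) that(2), of 1 "-1"] by simp
  have "(\<lambda>x. f x - u x) \<in> Ck_closure k (ball 0 1)"
    unfolding Ck_closure_def
  proof (intro CollectI conjI ballI allI impI)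
    show "(\<lambda>x. f x - u x) \<in> Ck_on k (ball 0 1)"
      using Ck_on_lincomb[OF open_ball fCk u(2), of 1 "-1"] by simp
    fix \<alpha> :: "'a multiset" and B :: "'a set"
    assume \<alpha>: "\<alpha> \<in> multi_indices k" and B: "B \<subseteq> ball 0 1 \<and> bounded B"
    obtain W where W: "open W" "cball 0 1 \<subseteq> W" "u \<in> Ck_on k W" using smooth[OF u(1)] by blast
    obtain bs where bs: "set bs \<subseteq> Basis" "length bs \<le> k" "multi_deriv \<alpha> = iter_partial bs"
      using multi_deriv_list[OF \<alpha>] .
    have "continuous_on (cball 0 1) (multi_deriv \<alpha> u)"
      unfolding bs(3) using Ck_on_iter_continuous[OF W(3) bs(1,2)] W(2) by (rule continuous_on_subset)
    then have "uniformly_continuous_on (cball 0 1) (multi_deriv \<alpha> u)"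
      by (intro compact_uniformly_continuous) auto
    then have "uniformly_continuous_on B (multi_deriv \<alpha> u)"
      using B ball_subset_cball unfolding uniformly_continuous_on_def by (metis subsetD)
    moreover have "uniformly_continuous_on B (multi_deriv \<alpha> f)"
      using assms(5) \<alpha> B by (auto simp: Ck_closure_def)
    ultimately have "uniformly_continuous_on B (\<lambda>x. multi_deriv \<alpha> f x - multi_deriv \<alpha> u x)"
      by (intro uniformly_continuous_on_diff)
    then show "uniformly_continuous_on B (multi_deriv \<alpha> (\<lambda>x. f x - u x))"
      using diff[OF \<alpha>] B unfolding uniformly_continuous_on_def by (metis subsetD)
  qed
  moreover have "Ck_norm k (ball 0 1) (\<lambda>x. f x - u x) \<le> (\<Sum>\<alpha>\<in>(multi_indices k :: 'a multiset set). e)"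
    unfolding Ck_norm_def
  proof (rule sum_mono)
    fix \<alpha> :: "'a multiset" assume \<alpha>: "\<alpha> \<in> multi_indices k"
    show "(SUP x\<in>ball 0 1. \<bar>multi_deriv \<alpha> (\<lambda>x. f x - u x) x\<bar>) \<le> e"
      using u(3) \<alpha> diff[OF \<alpha>] unfolding Ck_close_def by (intro cSUP_least) auto
  qed
  ultimately show ?thesis using u(1) e(2) unfolding S_def N_def by auto
qed

end
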